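(* Let $A(t), B(t)\in \mathbb{R}[\cos(t),\sin(t)]$ be real trigonometric polynomials and consider the Abel differential equation $x'=A(t)x^3+B(t)x^2$. If $\deg(A)$ is odd or $\deg(A)<2\deg(B)$, then the equation has at most two non-trivial rational limit cycles. Otherwise, the number of non-trivial rational limit cycles of the equation is at most $\deg(A)+1$.
   Context: $\mathbb{R}[\cos(t),\sin(t)]$ is the ring of real trigonometric polynomials, i.e. functions $\sum_{k=0}^n a_k\cos(kt)+b_k\sin(kt)$ with $a_k,b_k\in\mathbb{R}$. The degree of a non-zero real trigonometric polynomial is the largest $k$ such that $(a_k,b_k)\neq(0,0)$ (with $b_0=0$); non-zero constants have degree $0$, and by convention the zero polynomial is also given degree $0$. A periodic solution is a $2\pi$-periodic solution $x(t)$ of the equation, defined for all $t\in\mathbb{R}$. A limit cycle is a periodic solution that is isolated in the set of periodic solutions of the equation. A rational limit cycle is a limit cycle of the form $x(t)=Q(t)/P(t)$, where $P(t),Q(t)$ are real trigonometric polynomials and $P(t)\neq0$ for all $t\in\mathbb{R}$. It is non-trivial if it is not the zero solution $x(t)\equiv0$. *)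

theory Defs
  imports Complex_Main
begin

definition trig_expansion ::
    "nat \<Rightarrow> (nat \<Rightarrow> real) \<Rightarrow> (nat \<Rightarrow> real) \<Rightarrow> (real \<Rightarrow> real) \<Rightarrow> bool" where
  "trig_expansion n a b f \<longleftrightarrow>
     b 0 = 0 \<and> f = (\<lambda>t. \<Sum>k\<le>n. a k * cos (real k * t) + b k * sin (real k * t))"

definition trig_poly :: "(real \<Rightarrow> real) \<Rightarrow> bool" where
  "trig_poly f \<longleftrightarrow> (\<exists>n a b. trig_expansion n a b f)"

text \<open>The coefficients of a trigonometric polynomial are unique (\<open>trig_expansion_zero\<close> below), so
  the degree does not depend on the chosen expansion; see \<open>trig_degree_eqI\<close>.\<close>

definition trig_degree :: "(real \<Rightarrow> real) \<Rightarrow> nat" where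
  "trig_degree f =
     (if f = (\<lambda>t. 0) then 0
      else (GREATEST k. \<exists>n a b. trig_expansion n a b f \<and> k \<le> n \<and> (a k, b k) \<noteq> (0, 0)))"

definition abel_periodic_solution ::
    "(real \<Rightarrow> real) \<Rightarrow> (real \<Rightarrow> real) \<Rightarrow> (real \<Rightarrow> real) \<Rightarrow> bool" where
  "abel_periodic_solution A B x \<longleftrightarrow>
     (\<forall>t. (x has_real_derivative A t * x t ^ 3 + B t * x t ^ 2) (at t)) \<and>
     (\<forall>t. x (t + 2 * pi) = x t)"

text \<open>Isolation is with respect to uniform convergence; by uniqueness of solutions and continuous
  dependence on initial values, this is the same as isolation of the initial values.\<close>

definition abel_limit_cycle ::
    "(real \<Rightarrow> real) \<Rightarrow> (real \<Rightarrow> real) \<Rightarrow> (real \<Rightarrow> real) \<Rightarrow> bool" where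
  "abel_limit_cycle A B x \<longleftrightarrow>
     abel_periodic_solution A B x \<and>
     (\<exists>\<epsilon>>0. \<forall>y. abel_periodic_solution A B y \<and> (\<forall>t. \<bar>y t - x t\<bar> < \<epsilon>) \<longrightarrow> y = x)"

definition rational_limit_cycle ::
    "(real \<Rightarrow> real) \<Rightarrow> (real \<Rightarrow> real) \<Rightarrow> (real \<Rightarrow> real) \<Rightarrow> bool" where
  "rational_limit_cycle A B x \<longleftrightarrow>
     abel_limit_cycle A B x \<and>
     (\<exists>P Q. trig_poly P \<and> trig_poly Q \<and> (\<forall>t. P t \<noteq> 0) \<and> x = (\<lambda>t. Q t / P t))"

definition nontrivial_rational_limit_cycles ::
    "(real \<Rightarrow> real) \<Rightarrow> (real \<Rightarrow> real) \<Rightarrow> (real \<Rightarrow> real) set" where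
  "nontrivial_rational_limit_cycles A B =
     {x. rational_limit_cycle A B x \<and> x \<noteq> (\<lambda>t. 0)}"

lemma trig_expansion_zero:
  assumes "trig_expansion n a b (\<lambda>t. 0)" and "k \<le> n"
  shows "a k = 0 \<and> b k = 0"
  using assms
proof (induction n arbitrary: a b k)
  case 0
  then show ?case by (auto simp: trig_expansion_def fun_eq_iff)
next
  case (Suc n)
  define h where "h = pi / real (Suc n)"
  define c where "c k = 2 * (cos (real k * h) + 1)" for k :: nat
  define e where "e t k = a k * cos (real k * t) + b k * sin (real k * t)" for t :: real and k
  have b0: "b 0 = 0" and z: "(\<Sum>k\<le>Suc n. e t k) = 0" for t
    using Suc.prems(1) by (auto simp: trig_expansion_def fun_eq_iff e_def)
  have hn: "real (Suc n) * h = pi" by (simp add: h_def)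
  have cSn: "c (Suc n) = 0" unfolding c_def hn by simp
  have step: "c k * e t k = e (t + h) k + e (t - h) k + 2 * e t k" for t k
    unfolding e_def c_def distrib_left right_diff_distrib cos_add cos_diff sin_add sin_diff
    by algebra
  have "(\<Sum>k\<le>Suc n. c k * e t k) = 0" for t
  proof -
    have "(\<Sum>k\<le>Suc n. c k * e t k)
        = (\<Sum>k\<le>Suc n. e (t + h) k) + (\<Sum>k\<le>Suc n. e (t - h) k) + 2 * (\<Sum>k\<le>Suc n. e t k)"
      by (simp only: step sum.distrib sum_distrib_left)
    then show ?thesis by (simp only: z)
  qed
  then have "trig_expansion n (\<lambda>k. c k * a k) (\<lambda>k. c k * b k) (\<lambda>t. 0)"
    using b0 cSn by (simp add: trig_expansion_def fun_eq_iff e_def distrib_left mult.assoc)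
  note IH = Suc.IH[OF this]
  have cpos: "c k \<noteq> 0" if "k \<le> n" for k
  proof -
    have "real k * h < real (Suc n) * h"
      using that by (intro mult_strict_right_mono) (auto simp: h_def)
    then have "real k * h < pi" by (simp only: hn)
    moreover have "0 \<le> real k * h" by (simp add: h_def)
    ultimately have "cos pi < cos (real k * h)" by (intro cos_monotone_0_pi) auto
    then show ?thesis by (simp add: c_def)
  qed
  have low: "a k = 0 \<and> b k = 0" if "k \<le> n" for k
    using IH[OF that] cpos[OF that] by simp
  then have "(\<Sum>k\<le>n. e t k) = 0" for t by (intro sum.neutral) (auto simp: e_def)
  then have top: "e t (Suc n) = 0" for t using z[of t] by simp
  have "a (Suc n) = 0" using top[of 0] by (simp add: e_def)
  moreover have "b (Suc n) = 0"
  proof -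
    have "real (Suc n) * (h / 2) = pi / 2" using hn by simp
    then show ?thesis
      using top[of "h / 2"] unfolding e_def by (simp only: cos_pi_half sin_pi_half)
  qed
  ultimately show ?case using low Suc.prems(2) by (cases "k = Suc n") auto
qed

lemma trig_expansion_extend:
  assumes "trig_expansion n a b f" and "n \<le> m"
  shows "trig_expansion m (\<lambda>k. if k \<le> n then a k else 0) (\<lambda>k. if k \<le> n then b k else 0) f"
proof -
  have "(\<Sum>k\<le>n. a k * cos (real k * t) + b k * sin (real k * t))
      = (\<Sum>k\<le>m. (if k \<le> n then a k else 0) * cos (real k * t)
             + (if k \<le> n then b k else 0) * sin (real k * t))" for t
    using assms(2) by (intro sum.mono_neutral_cong_left) auto
  then show ?thesis using assms(1) by (simp add: trig_expansion_def)
qed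

lemma trig_expansion_unique:
  assumes "trig_expansion n a b f" and "trig_expansion n a' b' f" and "k \<le> n"
  shows "a k = a' k \<and> b k = b' k"
proof -
  have 1: "f t = (\<Sum>k\<le>n. a k * cos (real k * t) + b k * sin (real k * t))" for t
    using assms(1) by (simp add: trig_expansion_def)
  have 2: "f t = (\<Sum>k\<le>n. a' k * cos (real k * t) + b' k * sin (real k * t))" for t
    using assms(2) by (simp add: trig_expansion_def)
  have "(\<Sum>k\<le>n. (a k - a' k) * cos (real k * t) + (b k - b' k) * sin (real k * t)) = 0" for t
  proof -
    have "(\<Sum>k\<le>n. (a k - a' k) * cos (real k * t) + (b k - b' k) * sin (real k * t))
      = (\<Sum>k\<le>n. a k * cos (real k * t) + b k * sin (real k * t))
        - (\<Sum>k\<le>n. a' k * cos (real k * t) + b' k * sin (real k * t))"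
      unfolding sum_subtractf[symmetric] by (intro sum.cong) (auto simp: algebra_simps)
    then show ?thesis by (simp only: 1[symmetric] 2[symmetric])
  qed
  then have "trig_expansion n (\<lambda>k. a k - a' k) (\<lambda>k. b k - b' k) (\<lambda>t. 0)"
    using assms(1,2) by (simp add: trig_expansion_def)
  from trig_expansion_zero[OF this assms(3)] show ?thesis by simp
qed

lemma trig_degree_eqI:
  assumes f: "trig_expansion n a b f" and d: "d \<le> n" "(a d, b d) \<noteq> (0, 0)"
    and above: "\<And>k. d < k \<Longrightarrow> k \<le> n \<Longrightarrow> (a k, b k) = (0, 0)"
  shows "trig_degree f = d"
proof -
  have "f \<noteq> (\<lambda>t. 0)" using trig_expansion_zero[of n a b d] f d by auto
  moreover have "(GREATEST k. \<exists>n a b. trig_expansion n a b f \<and> k \<le> n \<and> (a k, b k) \<noteq> (0, 0)) = d"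
  proof (rule Greatest_equality)
    show "\<exists>n a b. trig_expansion n a b f \<and> d \<le> n \<and> (a d, b d) \<noteq> (0, 0)" using f d by blast
  next
    fix k assume "\<exists>n a b. trig_expansion n a b f \<and> k \<le> n \<and> (a k, b k) \<noteq> (0, 0)"
    then obtain m a' b' where k: "trig_expansion m a' b' f" "k \<le> m" "(a' k, b' k) \<noteq> (0, 0)"
      by blast
    show "k \<le> d"
    proof (rule ccontr)
      assume "\<not> k \<le> d"
      have "(if k \<le> n then a k else 0) = (if k \<le> m then a' k else 0) \<and>
            (if k \<le> n then b k else 0) = (if k \<le> m then b' k else 0)"
        using trig_expansion_unique[OF trig_expansion_extend[OF f, of "max n m"]
            trig_expansion_extend[OF k(1), of "max n m"], of k] k(2)
        by simp
      then show False using above[of k] k(2,3) \<open>\<not> k \<le> d\<close> by (auto split: if_splits)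
    qed
  qed
  ultimately show ?thesis by (simp add: trig_degree_def)
qed

end

theory Submission
  imports Defs "HOL-Analysis.Analysis"
    "HOL-Computational_Algebra.Polynomial_Factorial" "HOL-Computational_Algebra.Field_as_Ring"
begin

text \<open>
  Substituting \<open>z = exp (\<i> * t)\<close> turns trigonometric polynomials into Laurent polynomials in \<open>z\<close>.
  If \<open>x\<close> is a nonzero rational solution, then \<open>y = 1 / x\<close> satisfies \<open>y * y' + B * y + A = 0\<close>, and
  comparing pole orders shows that \<open>y\<close> is itself a trigonometric polynomial. The difference \<open>D\<close> of
  two such \<open>y, w\<close> satisfies \<open>D' * y * w = A * D\<close>, whence \<open>deg y + deg w = deg A\<close>. So if there are
  three of them, all have degree \<open>d = deg A / 2\<close>, and then \<open>deg B \<le> d\<close>; this is the first case.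
  In the second case the functions \<open>A / y = - (y' + B)\<close> lie in the space of trigonometric
  polynomials of degree at most \<open>d\<close>, which has dimension \<open>deg A + 1\<close>. A linear relation
  \<open>\<Sum>y. l y * A / y = 0\<close> makes \<open>\<Prod>y. (y - v) powr l y\<close> a first integral of the equation for
  \<open>v = 1 / x\<close>, periodic in \<open>t\<close>, so that every \<open>y\<close> with \<open>l y \<noteq> 0\<close> is surrounded by periodic
  solutions. Limit cycles therefore give linearly independent functions.
\<close>

section \<open>Laurent polynomials on the unit circle\<close>

text \<open>Multiplication by \<open>z ^ k\<close> clears the negative exponents, so ordinary
  polynomials suffice. Neither \<open>k\<close> nor \<open>p\<close> is canonical: a shift by any
  power of \<open>z\<close> represents the same function.\<close>

definition laurent_rep :: "(real \<Rightarrow> real) \<Rightarrow> nat \<Rightarrow> complex poly \<Rightarrow> bool" where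
  "laurent_rep f k p \<longleftrightarrow> (\<forall>t. complex_of_real (f t) * cis t ^ k = poly p (cis t))"

lemma laurent_repD: "laurent_rep f k p \<Longrightarrow> complex_of_real (f t) * cis t ^ k = poly p (cis t)"
  by (simp add: laurent_rep_def)

lemma infinite_unit_circle: "infinite (range cis)"
proof -
  have "inj_on cis {0..pi}"
    by (auto intro!: inj_onI dest!: arg_cong[of _ _ Re] simp: cos_inj_pi)
  moreover have "infinite {0..pi}" using infinite_Icc[OF pi_gt_zero] .
  ultimately have "infinite (cis ` {0..pi})" by (simp add: finite_image_iff)
  then show ?thesis by (meson finite_subset image_mono subset_UNIV)
qed

text \<open>A nonzero polynomial has finitely many roots. This turns identities between functions of
  \<open>t\<close> into polynomial identities, for which degrees and divisibility are
  available.\<close>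

lemma poly_eq_on_circle:
  assumes "\<And>t. poly p (cis t) = poly q (cis t)"
  shows "p = q"
proof (rule ccontr)
  assume "p \<noteq> q"
  then have "finite {z. poly (p - q) z = 0}" by (intro poly_roots_finite) simp
  moreover have "range cis \<subseteq> {z. poly (p - q) z = 0}" using assms by auto
  ultimately show False using infinite_unit_circle finite_subset by blast
qed

lemma laurent_rep_shift:
  "laurent_rep f k p \<Longrightarrow> laurent_rep f (k + j) (monom 1 j * p)"
  unfolding laurent_rep_def by (simp add: poly_monom power_add mult_ac)

lemma laurent_rep_add:
  "laurent_rep f k p \<Longrightarrow> laurent_rep g k q \<Longrightarrow> laurent_rep (\<lambda>t. f t + g t) k (p + q)"
  by (simp add: laurent_rep_def distrib_right)

lemma laurent_rep_cmult:
  "laurent_rep f k p \<Longrightarrow> laurent_rep (\<lambda>t. c * f t) k (smult (of_real c) p)"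
  by (simp add: laurent_rep_def mult.assoc)

lemma laurent_rep_mult:
  "laurent_rep f k p \<Longrightarrow> laurent_rep g j q \<Longrightarrow> laurent_rep (\<lambda>t. f t * g t) (k + j) (p * q)"
  by (simp add: laurent_rep_def power_add) (metis (no_types, opaque_lifting) mult.assoc mult.left_commute)

lemma laurent_rep_sum:
  assumes "\<And>i. i \<in> I \<Longrightarrow> laurent_rep (f i) k (p i)"
  shows "laurent_rep (\<lambda>t. \<Sum>i\<in>I. f i t) k (\<Sum>i\<in>I. p i)"
  using assms by (simp add: laurent_rep_def sum_distrib_right poly_sum)

section \<open>Differentiation with respect to the angle\<close>

lemma cis_has_vector_derivative: "(cis has_vector_derivative \<i> * cis t) (at t)"
  by (auto intro!: derivative_eq_intros simp: has_vector_derivative_def scaleR_conv_of_real mult_ac)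

lemma poly_cis_has_vector_derivative:
  "((\<lambda>t. poly p (cis t)) has_vector_derivative \<i> * cis t * poly (pderiv p) (cis t)) (at t)"
  using field_vector_diff_chain_at[OF cis_has_vector_derivative poly_DERIV]
  by (simp add: o_def)

text \<open>In the variable \<open>z\<close> the derivative is \<open>\<i> * z * d/dz\<close>; the
  term with \<open>of_nat k\<close> comes from differentiating the factor
  \<open>z ^ k\<close>.\<close>

lemma laurent_rep_deriv:
  assumes "laurent_rep f k p" and "\<And>t. (f has_real_derivative f' t) (at t)"
  shows "laurent_rep f' k (smult \<i> (pCons 0 (pderiv p) - smult (of_nat k) p))"
  unfolding laurent_rep_def
proof
  fix t
  have f: "((\<lambda>t. complex_of_real (f t)) has_vector_derivative complex_of_real (f' t)) (at t)"
    by (rule has_vector_derivative_of_real[OF assms(2)])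
  have "((\<lambda>t. complex_of_real (f t) * poly (monom 1 k) (cis t)) has_vector_derivative
      complex_of_real (f t) * (\<i> * cis t * poly (pderiv (monom 1 k)) (cis t)) +
      complex_of_real (f' t) * poly (monom 1 k) (cis t)) (at t)"
    by (rule has_vector_derivative_mult[OF f poly_cis_has_vector_derivative])
  moreover have "(\<lambda>t. complex_of_real (f t) * poly (monom 1 k) (cis t)) = (\<lambda>t. poly p (cis t))"
    using laurent_repD[OF assms(1)] by (simp add: poly_monom)
  ultimately have "complex_of_real (f t) * (\<i> * cis t * poly (pderiv (monom 1 k)) (cis t)) +
      complex_of_real (f' t) * poly (monom 1 k) (cis t) = \<i> * cis t * poly (pderiv p) (cis t)"
    using vector_derivative_unique_at poly_cis_has_vector_derivative by metis
  moreover have "cis t * poly (pderiv (monom 1 k)) (cis t) = of_nat k * cis t ^ k"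
    by (cases k) (simp_all add: pderiv_monom poly_monom)
  ultimately have "\<i> * of_nat k * (complex_of_real (f t) * cis t ^ k) + complex_of_real (f' t) * cis t ^ k
     = \<i> * cis t * poly (pderiv p) (cis t)"
    by (simp add: poly_monom mult_ac)
  then show "complex_of_real (f' t) * cis t ^ k =
    poly (smult \<i> (pCons 0 (pderiv p) - smult (of_nat k) p)) (cis t)"
    unfolding laurent_repD[OF assms(1)] by (simp add: algebra_simps)
qed

text \<open>Euler's formulas write the \<open>k\<close>-th term with \<open>z ^ k\<close> and
  \<open>z ^ (-k)\<close>; multiplication by \<open>z ^ d\<close> moves these exponents to
  \<open>d + k\<close> and \<open>d - k\<close>.\<close>

lemma trig_expansion_laurent_rep:
  assumes "trig_expansion d a b f"
  shows "laurent_rep f d (\<Sum>k\<le>d. monom (Complex (a k) (- b k) / 2) (d + k) + monom (Complex (a k) (b k) / 2) (d - k))"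
proof -
  have "laurent_rep (\<lambda>t. a k * cos (real k * t) + b k * sin (real k * t)) d
      (monom (Complex (a k) (- b k) / 2) (d + k) + monom (Complex (a k) (b k) / 2) (d - k))"
    if "k \<le> d" for k
    unfolding laurent_rep_def
  proof
    fix t
    have e1: "cis t ^ d = cis t ^ (d - k) * cis t ^ k" using that by (simp flip: power_add)
    have e2: "complex_of_real (a k * cos (real k * t) + b k * sin (real k * t)) * cis t ^ k
        = Complex (a k) (- b k) / 2 * cis t ^ (2 * k) + Complex (a k) (b k) / 2"
    proof -
      have "complex_of_real (a k * cos (real k * t) + b k * sin (real k * t)) =
         Complex (a k) (- b k) / 2 * cis (real k * t) + Complex (a k) (b k) / 2 * cis (- (real k * t))"
        by (simp add: complex_eq_iff field_simps)
      moreover have "cis (- (real k * t)) * cis (real k * t) = 1" by (simp add: cis_mult)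
      ultimately have "complex_of_real (a k * cos (real k * t) + b k * sin (real k * t)) * cis (real k * t)
        = Complex (a k) (- b k) / 2 * (cis (real k * t))\<^sup>2 + Complex (a k) (b k) / 2"
        by (simp add: distrib_right power2_eq_square mult.assoc)
      moreover have "cis (real k * t) = cis t ^ k" by (rule Complex.DeMoivre[symmetric])
      ultimately show ?thesis by (simp only: power_mult[symmetric] mult.commute[of k 2])
    qed
    have e3: "cis t ^ (d + k) = cis t ^ (d - k) * cis t ^ (2 * k)"
      using that by (simp add: add.commute flip: power_add)
    have "complex_of_real (a k * cos (real k * t) + b k * sin (real k * t)) * cis t ^ d
      = cis t ^ (d - k) * (complex_of_real (a k * cos (real k * t) + b k * sin (real k * t)) * cis t ^ k)"
      unfolding e1 by (simp only: mult_ac)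
    then show "complex_of_real (a k * cos (real k * t) + b k * sin (real k * t)) * cis t ^ d
      = poly (monom (Complex (a k) (- b k) / 2) (d + k) + monom (Complex (a k) (b k) / 2) (d - k)) (cis t)"
      unfolding e2 by (simp add: poly_monom e3 distrib_left mult_ac)
  qed
  then have "laurent_rep (\<lambda>t. \<Sum>k\<le>d. a k * cos (real k * t) + b k * sin (real k * t)) d
      (\<Sum>k\<le>d. monom (Complex (a k) (- b k) / 2) (d + k) + monom (Complex (a k) (b k) / 2) (d - k))"
    by (intro laurent_rep_sum) auto
  then show ?thesis using assms by (simp add: trig_expansion_def)
qed

lemma trig_poly_laurent_rep: "trig_poly f \<Longrightarrow> \<exists>k p. laurent_rep f k p"
  unfolding trig_poly_def using trig_expansion_laurent_rep by blast

text \<open>With \<open>degree p = 2 * d\<close> the highest exponent of the Laurent polynomial is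
  \<open>d\<close>. The zero function is excluded by \<open>p \<noteq> 0\<close> and has no degree
  here, unlike for \<open>trig_degree\<close>.\<close>

definition laurent_degree :: "(real \<Rightarrow> real) \<Rightarrow> nat \<Rightarrow> bool" where
  "laurent_degree f d \<longleftrightarrow> (\<exists>p. laurent_rep f d p \<and> p \<noteq> 0 \<and> degree p = 2 * d)"

text \<open>The coefficient of the highest exponent is half of \<open>a d - \<i> * b d\<close> (or
  \<open>a 0\<close> if \<open>d = 0\<close>), so it vanishes only if both real coefficients
  do.\<close>

lemma laurent_degree_trig_degree:
  assumes "trig_poly f" and "f \<noteq> (\<lambda>t. 0)"
  shows "laurent_degree f (trig_degree f)"
proof -
  obtain n a b where e: "trig_expansion n a b f" using assms(1) by (auto simp: trig_poly_def)
  define K where "K = {k. k \<le> n \<and> (a k, b k) \<noteq> (0, 0)}"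
  have "K \<noteq> {}"
  proof
    assume "K = {}"
    then have "f = (\<lambda>t. 0)" using e by (auto simp: trig_expansion_def K_def fun_eq_iff)
    with assms(2) show False by simp
  qed
  moreover have fin: "finite K" by (simp add: K_def)
  ultimately have dK: "Max K \<in> K" by (rule Max_in[rotated])
  define d where "d = Max K"
  have d: "d \<le> n" "(a d, b d) \<noteq> (0, 0)" using dK by (auto simp: K_def d_def)
  have above: "(a k, b k) = (0, 0)" if "d < k" "k \<le> n" for k
    using Max_ge[OF fin, of k] that unfolding K_def[symmetric] d_def[symmetric]
    by (auto simp: K_def)
  have deg: "trig_degree f = d" using trig_degree_eqI[OF e d above] .
  have "(\<Sum>k\<le>n. a k * cos (real k * t) + b k * sin (real k * t))
      = (\<Sum>k\<le>d. a k * cos (real k * t) + b k * sin (real k * t))" for t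
    using d(1) above by (intro sum.mono_neutral_right) auto
  then have ed: "trig_expansion d a b f" using e by (simp add: trig_expansion_def)
  define c where "c k = monom (Complex (a k) (- b k) / 2) (d + k) + monom (Complex (a k) (b k) / 2) (d - k)" for k
  have rep: "laurent_rep f d (\<Sum>k\<le>d. c k)"
    unfolding c_def by (rule trig_expansion_laurent_rep[OF ed])
  have "degree (\<Sum>k\<le>d. c k) \<le> 2 * d"
    unfolding c_def
    by (intro degree_sum_le degree_add_le order.trans[OF degree_monom_le]) auto
  moreover have "coeff (\<Sum>k\<le>d. c k) (2 * d) \<noteq> 0"
  proof -
    have "coeff (\<Sum>k\<le>d. c k) (2 * d) = (\<Sum>k\<le>d. coeff (c k) (2 * d))" by (simp add: coeff_sum)
    also have "\<dots> = (\<Sum>k\<in>{d}. coeff (c k) (2 * d))"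
      by (intro sum.mono_neutral_right) (auto simp: c_def)
    also have "\<dots> \<noteq> 0"
    \<comment> \<open>For \<open>d = 0\<close> the two monomials share the exponent \<open>0\<close>
      and add up to \<open>a 0\<close>, which is nonzero because \<open>b 0 = 0\<close>.\<close>
    proof (cases "d = 0")
      case True
      have "b 0 = 0" using e by (simp add: trig_expansion_def)
      then have "coeff (c 0) 0 = Complex (a 0) 0"
        using True by (simp only: c_def coeff_add coeff_monom) (simp add: complex_eq_iff)
      then show ?thesis using d True \<open>b 0 = 0\<close> by (simp add: complex_eq_iff)
    next
      case False
      then show ?thesis using d by (auto simp: c_def complex_eq_iff)
    qed
    finally show ?thesis .
  qed
  ultimately have "degree (\<Sum>k\<le>d. c k) = 2 * d" "(\<Sum>k\<le>d. c k) \<noteq> 0"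
    using le_degree by (force intro: antisym)+
  with rep show ?thesis unfolding laurent_degree_def deg by blast
qed

section \<open>Comparison and multiplication of degrees\<close>

lemma laurent_degree_unique:
  assumes "laurent_degree f d" and "laurent_degree f e"
  shows "d = e"
proof -
  obtain p q where p: "laurent_rep f d p" "p \<noteq> 0" "degree p = 2 * d"
    and q: "laurent_rep f e q" "q \<noteq> 0" "degree q = 2 * e"
    using assms by (auto simp: laurent_degree_def)
  have "monom 1 e * p = monom 1 d * q"
    using laurent_repD[OF laurent_rep_shift[OF p(1), of e]]
      laurent_repD[OF laurent_rep_shift[OF q(1), of d]]
    by (intro poly_eq_on_circle) (simp add: add.commute)
  then have "degree (monom 1 e * p) = degree (monom 1 d * q)" by simp
  then show ?thesis using p q by (simp add: degree_mult_eq degree_monom_eq)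
qed

lemma laurent_degree_mult:
  assumes "laurent_degree f d" and "laurent_degree g e"
  shows "laurent_degree (\<lambda>t. f t * g t) (d + e)"
proof -
  obtain p q where "laurent_rep f d p" "p \<noteq> 0" "degree p = 2 * d"
    and "laurent_rep g e q" "q \<noteq> 0" "degree q = 2 * e"
    using assms by (auto simp: laurent_degree_def)
  then show ?thesis unfolding laurent_degree_def
    by (intro exI[of _ "p * q"] conjI laurent_rep_mult) (auto simp: degree_mult_eq)
qed

lemma laurent_degree_le:
  assumes "laurent_degree f d" and "laurent_rep f k p" and "degree p \<le> 2 * k"
  shows "d \<le> k"
proof -
  obtain q where q: "laurent_rep f d q" "q \<noteq> 0" "degree q = 2 * d"
    using assms by (auto simp: laurent_degree_def)
  have "monom 1 k * q = monom 1 d * p"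
    using laurent_repD[OF laurent_rep_shift[OF q(1), of k]]
      laurent_repD[OF laurent_rep_shift[OF assms(2), of d]]
    by (intro poly_eq_on_circle) (simp add: add.commute)
  then have "degree (monom 1 k * q) = degree (monom 1 d * p)" by simp
  also have "\<dots> \<le> d + degree p"
    using degree_mult_le[of "monom 1 d" p] by (simp add: degree_monom_eq)
  finally have "k + 2 * d \<le> d + degree p" using q by (simp add: degree_mult_eq degree_monom_eq)
  then show ?thesis using assms(3) by simp
qed

section \<open>Existence of the degree, and degrees of derivatives\<close>

lemma split_off_monom:
  fixes p :: "complex poly"
  assumes "p \<noteq> 0"
  obtains m q where "p = monom 1 m * q" and "poly q 0 \<noteq> 0"
proof -
  obtain q where q: "p = [:- 0, 1:] ^ order 0 p * q" "\<not> [:- 0, 1:] dvd q"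
    using order_decomp[OF assms, of 0] by blast
  moreover have "[:- 0, 1:] ^ m = (monom 1 m :: complex poly)" for m
    by (simp add: monom_altdef)
  ultimately show thesis using that[of "order 0 p" q] by (simp add: dvd_iff_poly_eq_0)
qed

text \<open>Real functions have reciprocal Laurent polynomials, so the exponents occurring lie
  symmetrically around \<open>0\<close>.\<close>

lemma laurent_degree_exists:
  assumes "laurent_rep f k p" and "f \<noteq> (\<lambda>t. 0)"
  shows "\<exists>d. laurent_degree f d"
proof -
  have "p \<noteq> 0"
  proof
    assume "p = 0"
    then have "f t = 0" for t using laurent_repD[OF assms(1), of t] by simp
    with assms(2) show False by auto
  qed
  then obtain m q where q: "p = monom 1 m * q" "poly q 0 \<noteq> 0" by (rule split_off_monom)
  \<comment> \<open>The conjugate reciprocal of \<open>q\<close>: on the circle conjugation is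
    inversion, so \<open>r\<close> represents the conjugate of \<open>q\<close> up to the factor
    \<open>z ^ n\<close>.\<close>
  define r where "r = reflect_poly (map_poly cnj q)"
  define n where "n = degree q"
  have q0: "q \<noteq> 0" using q by auto
  have c0: "coeff (map_poly cnj q) 0 \<noteq> 0" using q by (simp add: coeff_map_poly poly_0_coeff_0)
  have dq: "degree (map_poly cnj q) = n" by (simp add: n_def degree_map_poly)
  have r: "degree r = n" "r \<noteq> 0" using c0 dq by (auto simp: r_def)
  have pr: "poly r (cis t) = cis t ^ n * cnj (poly q (cis t))" for t
  proof -
    have "poly r (cis t) = cis t ^ n * poly (map_poly cnj q) (cnj (cis t))"
      unfolding r_def by (subst poly_reflect_poly_nz) (simp_all add: dq cis_inverse cis_cnj)
    then show ?thesis by (simp add: poly_map_poly_cnj)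
  qed
  \<comment> \<open>This expresses that \<open>f\<close> equals its complex conjugate.\<close>
  have "monom 1 (2 * m + n) * q = monom 1 (2 * k) * r"
  proof (rule poly_eq_on_circle)
    fix t
    have 1: "complex_of_real (f t) * cis t ^ k = cis t ^ m * poly q (cis t)"
      using laurent_repD[OF assms(1), of t] by (simp add: q poly_monom)
    then have "complex_of_real (f t) * cnj (cis t) ^ k = cnj (cis t) ^ m * cnj (poly q (cis t))"
      by (metis complex_cnj_complex_of_real complex_cnj_mult complex_cnj_power)
    moreover have u: "cnj (cis t) ^ j * cis t ^ j = 1" for j
      by (simp flip: power_mult_distrib add: cis_cnj cis_mult)
    ultimately have 2: "complex_of_real (f t) * cis t ^ m = cis t ^ k * cnj (poly q (cis t))"
    proof -
      assume a: "complex_of_real (f t) * cnj (cis t) ^ k = cnj (cis t) ^ m * cnj (poly q (cis t))"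
      have "complex_of_real (f t) * cis t ^ m = (complex_of_real (f t) * cnj (cis t) ^ k) * cis t ^ k * cis t ^ m"
        using u[of k] by (simp add: mult.assoc)
      also have "\<dots> = cis t ^ k * cnj (poly q (cis t)) * (cnj (cis t) ^ m * cis t ^ m)"
        unfolding a by (simp add: mult_ac)
      finally show ?thesis unfolding u by simp
    qed
    have "poly (monom 1 (2 * m + n) * q) (cis t) = cis t ^ n * cis t ^ m * (cis t ^ m * poly q (cis t))"
      by (simp add: poly_monom power_add power_mult_distrib power2_eq_square power_mult mult.commute[of 2] mult.left_commute mult.assoc)
    also have "\<dots> = cis t ^ n * cis t ^ k * (complex_of_real (f t) * cis t ^ m)"
      unfolding 1[symmetric] by (simp only: mult_ac)
    also have "\<dots> = poly (monom 1 (2 * k) * r) (cis t)"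
      unfolding 2
      by (simp add: poly_monom pr power_add power_mult_distrib power2_eq_square power_mult mult.commute[of 2] mult.left_commute mult.assoc)
    finally show "poly (monom 1 (2 * m + n) * q) (cis t) = poly (monom 1 (2 * k) * r) (cis t)" .
  qed
  then have "degree (monom 1 (2 * m + n) * q) = degree (monom 1 (2 * k) * r)" by simp
  \<comment> \<open>Both \<open>q\<close> and \<open>r\<close> have degree \<open>n\<close>. In
    particular \<open>m \<le> k\<close>, so the subtraction \<open>k - m\<close> below is not
    truncated, and \<open>n = 2 * (k - m)\<close>.\<close>
  then have km: "2 * m + n = 2 * k"
    using q0 r by (simp add: degree_mult_eq degree_monom_eq n_def)
  have "laurent_rep f (k - m) q"
    unfolding laurent_rep_def
  proof
    fix t
    have "cis t ^ k = cis t ^ m * cis t ^ (k - m)" using km by (simp flip: power_add)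
    then have "cis t ^ m * (complex_of_real (f t) * cis t ^ (k - m)) = cis t ^ m * poly q (cis t)"
      using laurent_repD[OF assms(1), of t] by (simp add: q poly_monom mult_ac)
    then show "complex_of_real (f t) * cis t ^ (k - m) = poly q (cis t)" by simp
  qed
  then show ?thesis using q0 km unfolding laurent_degree_def n_def
    by (intro exI[of _ "k - m"] exI[of _ q]) auto
qed

text \<open>Differentiation multiplies the leading coefficient by \<open>\<i> * d\<close>, which is
  nonzero for \<open>d > 0\<close>.\<close>

lemma laurent_degree_deriv:
  assumes "laurent_degree f d" and "d > 0" and "\<And>t. (f has_real_derivative f' t) (at t)"
  shows "laurent_degree f' d"
proof -
  obtain p where p: "laurent_rep f d p" "p \<noteq> 0" "degree p = 2 * d"
    using assms by (auto simp: laurent_degree_def)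
  define q where "q = smult \<i> (pCons 0 (pderiv p) - smult (of_nat d) p)"
  have "degree (pCons 0 (pderiv p)) \<le> 2 * d"
    using p assms(2) by (simp add: degree_pCons_eq_if degree_pderiv)
  then have "degree q \<le> 2 * d"
    using p unfolding q_def by (intro order.trans[OF degree_smult_le] degree_diff_le) auto
  moreover have "coeff q (2 * d) \<noteq> 0"
  proof -
    obtain e where e: "2 * d = Suc e" using assms(2) by (cases "2 * d") auto
    have "coeff q (2 * d) = \<i> * (of_nat (2 * d) * coeff p (2 * d) - of_nat d * coeff p (2 * d))"
      unfolding q_def by (simp add: e coeff_pderiv del: of_nat_Suc)
    also have "\<dots> = \<i> * of_nat d * coeff p (2 * d)" by (simp add: algebra_simps)
    also have "\<dots> \<noteq> 0" using assms(2) p leading_coeff_0_iff[of p] by simp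
    finally show ?thesis .
  qed
  ultimately have "degree q = 2 * d" "q \<noteq> 0"
    using le_degree by (force intro: antisym)+
  moreover have "laurent_rep f' d q"
    unfolding q_def by (rule laurent_rep_deriv[OF p(1) assms(3)])
  ultimately show ?thesis unfolding laurent_degree_def by blast
qed

lemma laurent_degree_0_constant:
  assumes "laurent_degree f 0"
  shows "f s = f t"
proof -
  obtain p where "laurent_rep f 0 p" "degree p = 0" using assms by (auto simp: laurent_degree_def)
  then have "complex_of_real (f s) = complex_of_real (f t)"
    by (auto simp: laurent_rep_def elim!: degree_eq_zeroE)
  then show ?thesis by simp
qed

section \<open>Reciprocals of rational solutions and linear relations\<close>

text \<open>After splitting off the power of \<open>z\<close>, the remaining factor \<open>q\<close>
  is coprime to \<open>z\<close>, so it divides its own derivative. That derivative has smaller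
  degree unless it is zero, so \<open>q\<close> is constant.\<close>

lemma monom_if_dvd_pderiv:
  fixes a :: "complex poly"
  assumes "a \<noteq> 0" and "a dvd monom 1 n * pderiv a"
  obtains c k where "a = monom c k"
proof -
  obtain k q where q: "a = monom 1 k * q" "poly q 0 \<noteq> 0" using split_off_monom[OF assms(1)] .
  have "coprime q [:0, 1:]"
  proof (rule coprimeI)
    fix r assume r: "r dvd q" "r dvd [:0, 1:]"
    from r(2) obtain s where s: "[:0, 1:] = r * s" by (elim dvdE)
    have "r \<noteq> 0" "s \<noteq> 0" using s by auto
    then have "degree r + degree s = 1" using arg_cong[OF s, of degree]
      by (simp add: degree_mult_eq)
    moreover have "degree r \<noteq> 1"
    proof
      assume "degree r = 1"
      with calculation have "degree s = 0" by simp
      then obtain e where "s = [:e:]" by (elim degree_eq_zeroE)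
      moreover have "poly r 0 * poly s 0 = 0" using arg_cong[OF s, of "\<lambda>p. poly p 0"] by simp
      ultimately have "poly r 0 = 0" using \<open>s \<noteq> 0\<close> by auto
      then show False using r(1) q(2) by (auto elim!: dvdE)
    qed
    ultimately have "degree r = 0" by simp
    then show "is_unit r" using \<open>r \<noteq> 0\<close> by (simp add: is_unit_iff_degree)
  qed
  then have cop: "coprime q (monom 1 j)" for j by (simp add: monom_altdef)
  have "q dvd monom 1 n * (monom 1 k * pderiv q + q * pderiv (monom 1 k))"
    using dvd_trans[of q a] assms(2) unfolding q(1) pderiv_mult by simp
  then have "q dvd monom 1 n * (monom 1 k * pderiv q) + q * (monom 1 n * pderiv (monom 1 k))"
    by (simp add: algebra_simps)
  then have "q dvd monom 1 n * (monom 1 k * pderiv q)" by (simp add: dvd_add_left_iff)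
  then have "q dvd pderiv q" using cop by (simp add: coprime_dvd_mult_right_iff)
  then have "degree q = 0"
    using dvd_imp_degree_le[of q "pderiv q"]
    by (cases "pderiv q = 0") (auto simp: degree_pderiv pderiv_eq_0_iff)
  then obtain c where "q = [:c:]" by (elim degree_eq_zeroE)
  then have "a = monom c k" using q(1) by (simp add: smult_monom)
  then show thesis using that by blast
qed

text \<open>Reduction to lowest terms over the complex polynomials. The denominator \<open>v\<close>
  has no zero on the circle, hence neither has the common factor, and it cancels pointwise.\<close>

lemma trig_quotient_laurent:
  assumes "trig_poly P" and "trig_poly Q" and "\<And>t. P t \<noteq> 0"
  obtains a b where "coprime a b" and "\<And>t. poly b (cis t) \<noteq> 0"
    and "\<And>t. complex_of_real (Q t / P t) * poly b (cis t) = poly a (cis t)"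
proof -
  obtain m q n p where q: "laurent_rep Q m q" and p: "laurent_rep P n p"
    using assms(1,2)[THEN trig_poly_laurent_rep] by auto
  \<comment> \<open>The powers of \<open>z\<close> are exchanged crosswise because \<open>Q\<close>
    and \<open>P\<close> are represented with different exponents.\<close>
  define u v where "u = monom 1 n * q" and "v = monom 1 m * p"
  have v: "poly v (cis t) \<noteq> 0" for t
    using laurent_repD[OF p, of t] assms(3)[of t] by (auto simp: v_def poly_monom)
  then have "v \<noteq> 0" by auto
  then obtain a b where ab: "u = a * gcd u v" "v = b * gcd u v" "coprime a b"
    using gcd_coprime_exists[of u v] by auto
  have bv: "poly v (cis t) = poly b (cis t) * poly (gcd u v) (cis t)" for t
    using ab(2) poly_mult by metis
  have au: "poly u (cis t) = poly a (cis t) * poly (gcd u v) (cis t)" for t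
    using ab(1) poly_mult by metis
  have "complex_of_real (Q t / P t) * poly v (cis t) = poly u (cis t)" for t
    using laurent_repD[OF p, of t] laurent_repD[OF q, of t] assms(3)[of t]
    by (simp add: u_def v_def poly_monom field_simps)
  then have "complex_of_real (Q t / P t) * poly b (cis t) * poly (gcd u v) (cis t)
      = poly a (cis t) * poly (gcd u v) (cis t)" for t
    unfolding au bv by (simp only: mult.assoc)
  then have "complex_of_real (Q t / P t) * poly b (cis t) = poly a (cis t)" for t
    using v[of t] unfolding bv by (metis mult_right_cancel mult_eq_0_iff)
  moreover have "poly b (cis t) \<noteq> 0" for t using v[of t] bv by auto
  ultimately show thesis using that ab(3) by blast
qed

text \<open>Written in lowest terms \<open>x = a / b\<close>, the equation shows that \<open>a\<close> divides \<open>z ^ n * a'\<close>,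
  so \<open>a\<close> is a monomial.\<close>

lemma rational_solution_reciprocal:
  assumes A: "trig_poly A" and B: "trig_poly B" and P: "trig_poly P" and Q: "trig_poly Q"
    and P0: "\<And>t. P t \<noteq> 0" and x: "x = (\<lambda>t. Q t / P t)" and x0: "x \<noteq> (\<lambda>t. 0)"
    and ode: "\<And>t. (x has_real_derivative A t * x t ^ 3 + B t * x t ^ 2) (at t)"
  shows "(\<forall>t. x t \<noteq> 0) \<and> (\<exists>k p. laurent_rep (\<lambda>t. 1 / x t) k p)"
proof -
  obtain a b where ab: "coprime a b" and b0: "\<And>t. poly b (cis t) \<noteq> 0"
    and xab: "\<And>t. complex_of_real (x t) * poly b (cis t) = poly a (cis t)"
    using trig_quotient_laurent[OF P Q P0] x by auto
  obtain k1 \<alpha>1 k2 \<beta>1 where AB: "laurent_rep A k1 \<alpha>1" "laurent_rep B k2 \<beta>1"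
    using A B trig_poly_laurent_rep by meson
  define n \<alpha> \<beta> where "n = k1 + k2" and "\<alpha> = monom 1 k2 * \<alpha>1" and "\<beta> = monom 1 k1 * \<beta>1"
  have \<alpha>: "laurent_rep A n \<alpha>" and \<beta>: "laurent_rep B n \<beta>"
    using laurent_rep_shift[OF AB(1), of k2] laurent_rep_shift[OF AB(2), of k1]
    by (simp_all add: n_def \<alpha>_def \<beta>_def add.commute)
  have a0: "a \<noteq> 0"
  proof
    assume "a = 0"
    then have "x t = 0" for t using xab[of t] b0[of t] by simp
    with x0 show False by auto
  qed
  \<comment> \<open>The derivative of \<open>x * b = a\<close>, multiplied by
    \<open>z ^ n * b\<^sup>2\<close>, with \<open>x'\<close> replaced by means of the equation. All
    terms except the one with \<open>pderiv a\<close> contain \<open>x * b\<close>, that is,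
    \<open>a\<close>.\<close>
  have "a * (\<alpha> * a\<^sup>2 + \<beta> * a * b + monom \<i> (Suc n) * b * pderiv b)
      = smult \<i> (monom 1 (Suc n) * pderiv a * b\<^sup>2)"
  proof (rule poly_eq_on_circle)
    fix t
    define z u v where "z = cis t" and "u = poly a z" and "v = poly b z"
    define X where "X = complex_of_real (x t)"
    have Xv: "X * v = u" using xab[of t] by (simp add: X_def z_def u_def v_def)
    have "((\<lambda>t. complex_of_real (x t)) has_vector_derivative
        complex_of_real (A t * x t ^ 3 + B t * x t ^ 2)) (at t)"
      by (rule has_vector_derivative_of_real[OF ode])
    from has_vector_derivative_mult[OF this poly_cis_has_vector_derivative[of b]]
    have "((\<lambda>t. poly a (cis t)) has_vector_derivative
      X * (\<i> * z * poly (pderiv b) z) + complex_of_real (A t * x t ^ 3 + B t * x t ^ 2) * v) (at t)"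
      unfolding xab X_def z_def v_def .
    from vector_derivative_unique_at[OF this poly_cis_has_vector_derivative]
    have "X * (\<i> * z * poly (pderiv b) z) + (complex_of_real (A t) * X ^ 3 + complex_of_real (B t) * X ^ 2) * v
       = \<i> * z * poly (pderiv a) z"
      by (simp add: X_def z_def)
    then have e1: "(X * (\<i> * z * poly (pderiv b) z) + (complex_of_real (A t) * X ^ 3 + complex_of_real (B t) * X ^ 2) * v)
         * z ^ n * v\<^sup>2 = \<i> * z * poly (pderiv a) z * z ^ n * v\<^sup>2" by simp
    have e2: "(X * (\<i> * z * poly (pderiv b) z) + (complex_of_real (A t) * X ^ 3 + complex_of_real (B t) * X ^ 2) * v)
         * z ^ n * v\<^sup>2 = (X * v) * (\<i> * z * z ^ n * v * poly (pderiv b) z)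
          + (complex_of_real (A t) * z ^ n) * (X * v) ^ 3 + (complex_of_real (B t) * z ^ n) * (X * v) ^ 2 * v"
      by (simp add: algebra_simps power2_eq_square power3_eq_cube)
    have "u * (\<i> * z * z ^ n * v * poly (pderiv b) z) + poly \<alpha> z * u ^ 3 + poly \<beta> z * u ^ 2 * v
       = \<i> * z * poly (pderiv a) z * z ^ n * v\<^sup>2"
      using trans[OF sym[OF e2] e1]
      unfolding Xv laurent_repD[OF \<alpha>, of t, folded z_def] laurent_repD[OF \<beta>, of t, folded z_def] .
    then show "poly (a * (\<alpha> * a\<^sup>2 + \<beta> * a * b + monom \<i> (Suc n) * b * pderiv b)) (cis t)
      = poly (smult \<i> (monom 1 (Suc n) * pderiv a * b\<^sup>2)) (cis t)"
      unfolding z_def[symmetric]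
      by (simp add: poly_monom u_def[symmetric] v_def[symmetric] algebra_simps power2_eq_square power3_eq_cube)
  qed
  then have "a dvd smult \<i> (monom 1 (Suc n) * pderiv a * b\<^sup>2)" by (metis dvd_triv_left)
  then have "a dvd monom 1 (Suc n) * pderiv a * b\<^sup>2" by (simp add: dvd_smult_iff)
  moreover have "coprime a (b\<^sup>2)" using ab by simp
  ultimately have "a dvd monom 1 (Suc n) * pderiv a" by (simp add: coprime_dvd_mult_left_iff)
  then obtain c k where a: "a = monom c k" using monom_if_dvd_pderiv[OF a0] by blast
  have c: "c \<noteq> 0" using a a0 by auto
  \<comment> \<open>As \<open>c\<close> is nonzero, \<open>x\<close> has no zero, and
    \<open>1 / x\<close> is \<open>b\<close> divided by \<open>c * z ^ k\<close>, a Laurent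
    polynomial.\<close>
  have xc: "complex_of_real (x t) * poly b (cis t) = c * cis t ^ k" for t
    using xab[of t] a by (simp add: poly_monom)
  have nz: "x t \<noteq> 0" for t using xc[of t] c by auto
  have "laurent_rep (\<lambda>t. 1 / x t) k (smult (1 / c) b)"
    unfolding laurent_rep_def using xc nz c by (simp add: field_simps)
  then show ?thesis using nz by blast
qed

text \<open>With \<open>H\<close> a primitive of \<open>h\<close>, the product
  \<open>D * exp (- H)\<close> is constant. Applied to differences of solutions this gives
  uniqueness.\<close>

lemma linear_ode_zero:
  assumes D: "\<And>t. (D has_real_derivative h t * D t) (at t)" and h: "continuous_on UNIV h"
    and "D s = (0::real)"
  shows "D t = 0"
proof -
  define a b where "a = min s t - 1" and "b = max s t + 1"
  define H where "H u = integral {a..u} h" for u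
  have H: "(H has_real_derivative h u) (at u within {a..b})" if "u \<in> {a..b}" for u
    unfolding H_def using that continuous_on_subset[OF h]
    by (intro integral_has_real_derivative) auto
  have "((\<lambda>u. D u * exp (- H u)) has_real_derivative 0) (at u within {a..b})" if "u \<in> {a..b}" for u
    by (rule derivative_eq_intros refl H[OF that] has_field_derivative_at_within[OF D])+ simp
  then obtain c where "\<And>u. u \<in> {a..b} \<Longrightarrow> D u * exp (- H u) = c"
    using has_field_derivative_zero_constant[of "{a..b}" "\<lambda>u. D u * exp (- H u)"] by auto
  moreover have "s \<in> {a..b}" "t \<in> {a..b}" by (auto simp: a_def b_def)
  ultimately have "D t * exp (- H t) = D s * exp (- H s)" by metis
  then show ?thesis using assms(3) by simp
qed

text \<open>Gaussian elimination: unless the last equation is trivial, it is solved for an unknown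
  \<open>l j\<close> with nonzero coefficient, and substitution leaves one equation and one unknown
  fewer. The coefficients \<open>e\<close> are those after the substitution.\<close>

lemma homogeneous_system_nontrivial:
  fixes c :: "nat \<Rightarrow> 'a \<Rightarrow> real"
  assumes "finite S" and "m < card S"
  shows "\<exists>l. (\<exists>i\<in>S. l i \<noteq> 0) \<and> (\<forall>k<m. (\<Sum>i\<in>S. l i * c k i) = 0)"
  using assms
proof (induction m arbitrary: S c)
  case 0
  then obtain i where "i \<in> S" by fastforce
  then show ?case by (intro exI[of _ "\<lambda>_. 1"]) auto
next
  case (Suc m)
  show ?case
  proof (cases "\<forall>i\<in>S. c m i = 0")
    case True
    obtain l where "\<exists>i\<in>S. l i \<noteq> 0" "\<forall>k<m. (\<Sum>i\<in>S. l i * c k i) = 0"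
      using Suc.IH[OF Suc.prems(1), of c] Suc.prems(2) by auto
    then show ?thesis using True by (intro exI[of _ l]) (auto simp: less_Suc_eq)
  next
    case False
    then obtain j where j: "j \<in> S" "c m j \<noteq> 0" by blast
    define e where "e k i = c k i - c k j * c m i / c m j" for k i
    have "m < card (S - {j})" using Suc.prems j by simp
    then obtain l where l: "\<exists>i\<in>S - {j}. l i \<noteq> 0" "\<forall>k<m. (\<Sum>i\<in>S - {j}. l i * e k i) = 0"
      using Suc.IH[of "S - {j}" e] Suc.prems(1) by auto
    define s where "s = (\<Sum>i\<in>S - {j}. l i * c m i)"
    define l' where "l' = l(j := - s / c m j)"
    have split: "(\<Sum>i\<in>S. l' i * c k i) = (\<Sum>i\<in>S - {j}. l i * c k i) - s / c m j * c k j" for k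
    proof -
      have "(\<Sum>i\<in>S. l' i * c k i) = l' j * c k j + (\<Sum>i\<in>S - {j}. l' i * c k i)"
        using Suc.prems(1) j(1) by (rule sum.remove)
      moreover have "(\<Sum>i\<in>S - {j}. l' i * c k i) = (\<Sum>i\<in>S - {j}. l i * c k i)"
        by (intro sum.cong) (auto simp: l'_def)
      ultimately show ?thesis by (simp add: l'_def)
    qed
    have "(\<Sum>i\<in>S - {j}. l i * e k i) = (\<Sum>i\<in>S - {j}. l i * c k i) - s / c m j * c k j" for k
    proof -
      have "s / c m j * c k j = (\<Sum>i\<in>S - {j}. l i * c m i / c m j * c k j)"
        by (simp add: s_def sum_divide_distrib sum_distrib_right)
      then show ?thesis by (simp add: e_def right_diff_distrib sum_subtractf mult_ac)
    qed
    then have "\<forall>k<m. (\<Sum>i\<in>S. l' i * c k i) = 0" using l(2) split by metis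
    moreover have "(\<Sum>i\<in>S. l' i * c m i) = 0" using split[of m] j(2) by (simp add: s_def)
    moreover have "\<exists>i\<in>S. l' i \<noteq> 0" using l(1) by (auto simp: l'_def)
    ultimately show ?thesis by (intro exI[of _ l']) (auto simp: less_Suc_eq)
  qed
qed

text \<open>A Laurent polynomial with exponents in \<open>{-d..d}\<close> that vanishes at \<open>2 * d + 1\<close> points of the
  unit circle is zero, so vanishing amounts to \<open>2 * d + 1\<close> linear conditions.\<close>

lemma laurent_dependent:
  assumes fin: "finite S" and card: "2 * d + 1 < card S"
    and rep: "\<And>i. i \<in> S \<Longrightarrow> \<exists>p. laurent_rep (f i) d p \<and> degree p \<le> 2 * d"
  shows "\<exists>l. (\<exists>i\<in>S. l i \<noteq> 0) \<and> (\<forall>t. (\<Sum>i\<in>S. l i * f i t) = 0)"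
proof -
  obtain p where p: "\<And>i. i \<in> S \<Longrightarrow> laurent_rep (f i) d (p i) \<and> degree (p i) \<le> 2 * d"
    using rep by metis
  obtain Z where Z: "Z \<subseteq> range cis" "finite Z" "card Z = 2 * d + 1"
    using infinite_arbitrarily_large[OF infinite_unit_circle] by blast
  obtain z where z: "bij_betw z {..<2 * d + 1} Z"
    using ex_bij_betw_nat_finite[OF Z(2)] Z(3) by (auto simp: atLeast0LessThan)
  have "\<forall>k. \<exists>t. k < 2 * d + 1 \<longrightarrow> z k = cis t"
    using z Z(1) by (auto simp: bij_betw_def)
  then obtain \<tau> where \<tau>: "\<And>k. k < 2 * d + 1 \<Longrightarrow> z k = cis (\<tau> k)" by metis
  \<comment> \<open>The conditions are on the values of the real functions \<open>f i\<close>, not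
    on the complex polynomials, so the multipliers come out real.\<close>
  obtain l where l: "\<exists>i\<in>S. l i \<noteq> 0" "\<forall>k<2 * d + 1. (\<Sum>i\<in>S. l i * f i (\<tau> k)) = 0"
    using homogeneous_system_nontrivial[OF fin card, of "\<lambda>k i. f i (\<tau> k)"] by blast
  define q where "q = (\<Sum>i\<in>S. smult (of_real (l i)) (p i))"
  have q: "laurent_rep (\<lambda>t. \<Sum>i\<in>S. l i * f i t) d q"
    unfolding q_def using p by (intro laurent_rep_sum laurent_rep_cmult) auto
  have "poly q w = 0" if "w \<in> Z" for w
  proof -
    have "w \<in> z ` {..<2 * d + 1}" using z that by (simp add: bij_betw_def)
    then obtain k where "k < 2 * d + 1" "w = z k" by blast
    then show ?thesis using laurent_repD[OF q, of "\<tau> k"] l(2) \<tau> by auto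
  qed
  then have "Z \<subseteq> {w. poly q w = 0}" by auto
  moreover have "degree q \<le> 2 * d"
    unfolding q_def using p
    by (intro degree_sum_le fin order.trans[OF degree_smult_le]) auto
  ultimately have "q = 0"
    using card_mono[of "{w. poly q w = 0}" Z] poly_roots_finite[of q] card_poly_roots_bound[of q] Z(3)
    by fastforce
  then have "(\<Sum>i\<in>S. l i * f i t) = 0" for t using laurent_repD[OF q, of t]
    by (simp flip: of_real_mult of_real_sum)
  then show ?thesis using l(1) by blast
qed

section \<open>Periodic functions and implicit curves\<close>

lemma periodic_reduce:
  fixes f :: "real \<Rightarrow> real"
  assumes "\<And>t. f (t + 2 * pi) = f t"
  obtains s where "s \<in> {0..2 * pi}" and "f s = f t"
proof -
  interpret periodic_fun_simple f "2 * pi" using assms by unfold_locales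
  define s where "s = t - of_int \<lfloor>t / (2 * pi)\<rfloor> * (2 * pi)"
  have "of_int \<lfloor>t / (2 * pi)\<rfloor> * (2 * pi) \<le> t / (2 * pi) * (2 * pi)"
    by (intro mult_right_mono) auto
  moreover have "t / (2 * pi) * (2 * pi) \<le> (of_int \<lfloor>t / (2 * pi)\<rfloor> + 1) * (2 * pi)"
    by (intro mult_right_mono) (linarith, simp)
  ultimately have "s \<in> {0..2 * pi}" by (simp add: s_def algebra_simps)
  moreover have "f s = f t" unfolding s_def by (rule minus_of_int)
  ultimately show thesis by (rule that)
qed

lemma periodic_bounded:
  fixes f :: "real \<Rightarrow> real"
  assumes "\<And>t. f (t + 2 * pi) = f t" and "continuous_on UNIV f"
  shows "\<exists>K. \<forall>t. \<bar>f t\<bar> \<le> K"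
proof -
  have "continuous_on {0..2 * pi} (\<lambda>t. \<bar>f t\<bar>)"
    using continuous_on_subset[OF assms(2)] by (intro continuous_intros) auto
  from continuous_attains_sup[OF compact_Icc _ this]
  obtain c where "\<And>s. s \<in> {0..2 * pi} \<Longrightarrow> \<bar>f s\<bar> \<le> \<bar>f c\<bar>" by fastforce
  then have "\<bar>f t\<bar> \<le> \<bar>f c\<bar>" for t by (metis periodic_reduce[of f t, OF assms(1)])
  then show ?thesis by blast
qed

lemma periodic_bounded_away:
  fixes f :: "real \<Rightarrow> real"
  assumes "\<And>t. f (t + 2 * pi) = f t" and "continuous_on UNIV f" and "\<And>t. f t \<noteq> 0"
  shows "\<exists>m>0. \<forall>t. m \<le> \<bar>f t\<bar>"
proof -
  have "continuous_on UNIV (\<lambda>t. inverse (f t))" using assms by (intro continuous_intros) auto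
  then obtain K where K: "\<bar>inverse (f t)\<bar> \<le> K" for t
    using periodic_bounded[of "\<lambda>t. inverse (f t)"] assms(1) by auto
  have "0 < \<bar>inverse (f 0)\<bar>" using assms(3)[of 0] by simp
  then have "0 < K" using K[of 0] by linarith
  moreover have "inverse K \<le> \<bar>f t\<bar>" for t
    using le_imp_inverse_le[OF K[of t]] assms(3)[of t] by (simp add: abs_inverse)
  ultimately show ?thesis by (intro exI[of _ "inverse K"]) auto
qed

text \<open>A global form of the implicit function theorem. \<open>L t\<close> is strictly
  increasing and crosses the level \<open>C\<close> between \<open>a\<close> and \<open>b\<close>,
  which gives a unique \<open>u t\<close> for every \<open>t\<close>; its derivative comes from
  implicit differentiation.\<close>

lemma implicit_curve:
  fixes L Lu Lt :: "real \<Rightarrow> real \<Rightarrow> real"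
  assumes Lu: "\<And>t u. 0 < u \<Longrightarrow> u < \<omega> \<Longrightarrow> (L t has_real_derivative Lu t u) (at u)"
    and pos: "\<And>t u. 0 < u \<Longrightarrow> u < \<omega> \<Longrightarrow> 0 < Lu t u"
    and cont: "\<And>t u. 0 < u \<Longrightarrow> u < \<omega> \<Longrightarrow> isCont (\<lambda>p. Lu (fst p) (snd p)) (t, u)"
    and Lt: "\<And>t u. 0 < u \<Longrightarrow> u < \<omega> \<Longrightarrow> ((\<lambda>t. L t u) has_real_derivative Lt t u) (at t)"
    and ab: "0 < a" "a < b" "b < \<omega>"
    and C: "\<And>t. L t a < C" "\<And>t. C < L t b"
  obtains u where "\<And>t. a < u t \<and> u t < b" and "\<And>t. L t (u t) = C"
    and "\<And>t v. 0 < v \<Longrightarrow> v < \<omega> \<Longrightarrow> L t v = C \<Longrightarrow> v = u t"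
    and "\<And>t. (u has_real_derivative - Lt t (u t) / Lu t (u t)) (at t)"
proof -
  have mono: "L t v < L t w" if "0 < v" "v < w" "w < \<omega>" for t v w
  proof (rule DERIV_pos_imp_increasing[OF that(2)])
    fix x assume "v \<le> x" "x \<le> w"
    then show "\<exists>y. DERIV (L t) x :> y \<and> 0 < y" using Lu[of x t] pos[of x t] that by auto
  qed
  have "\<exists>u. a \<le> u \<and> u \<le> b \<and> L t u = C" for t
  proof (rule IVT)
    show "\<forall>v. a \<le> v \<and> v \<le> b \<longrightarrow> isCont (L t) v"
      using ab by (auto intro!: DERIV_isCont[OF Lu])
  qed (use C[of t] ab in auto)
  then obtain u where u: "\<And>t. a \<le> u t \<and> u t \<le> b \<and> L t (u t) = C" by metis
  have eq: "L t (u t) = C" for t using u by blast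
  have ub: "a < u t \<and> u t < b" for t
    using u[of t] C[of t] by (metis less_le less_irrefl)
  have u\<omega>: "0 < u t" "u t < \<omega>" for t using ub[of t] ab by auto
  have uniq: "v = u t" if "0 < v" "v < \<omega>" "L t v = C" for t v
    using mono[of v "u t" t] mono[of "u t" v t] that eq[of t] u\<omega>[of t]
    by (metis less_irrefl linorder_neqE)
  have der: "(u has_real_derivative - Lt s (u s) / Lu s (u s)) (at s)" for s
  proof -
    \<comment> \<open>At time \<open>s\<close> the values of \<open>L\<close> at
      \<open>u s - r\<close> and \<open>u s + r\<close> lie on opposite sides of \<open>C\<close>.
      This persists for \<open>t\<close> near \<open>s\<close> and traps \<open>u t\<close> between
      these two points.\<close>
    have contu: "(u \<longlongrightarrow> u s) (at s)"
    proof (rule tendstoI)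
      fix e :: real assume "0 < e"
      define r where "r = min e (min (u s) (\<omega> - u s)) / 2"
      have r: "0 < r" "r < e" "0 < u s - r" "u s + r < \<omega>"
      proof -
        have "0 < 2 * r" "2 * r \<le> e" "2 * r \<le> u s" "2 * r \<le> \<omega> - u s"
          using \<open>0 < e\<close> u\<omega>[of s] by (auto simp: r_def)
        then show "0 < r" "r < e" "0 < u s - r" "u s + r < \<omega>" by auto
      qed
      have lim: "((\<lambda>t. L t v) \<longlongrightarrow> L s v) (at s)" if "0 < v" "v < \<omega>" for v
        using DERIV_isCont[OF Lt[OF that, of s]] by (simp add: isCont_def)
      have "L s (u s - r) < C" "C < L s (u s + r)"
        using mono[of "u s - r" "u s" s] mono[of "u s" "u s + r" s] r u\<omega>[of s] eq[of s] by auto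
      then have "\<forall>\<^sub>F t in at s. L t (u s - r) < C" "\<forall>\<^sub>F t in at s. C < L t (u s + r)"
        using order_tendstoD[OF lim] r u\<omega>[of s] by auto
      then show "\<forall>\<^sub>F t in at s. dist (u t) (u s) < e"
      proof eventually_elim
        case (elim t)
        have "u s - r < u t"
        proof (rule ccontr)
          assume "\<not> u s - r < u t"
          then have "L t (u t) \<le> L t (u s - r)"
            using mono[of "u t" "u s - r" t] u\<omega>[of t] u\<omega>[of s] r by (cases "u t = u s - r") auto
          then show False using elim eq[of t] by simp
        qed
        moreover have "u t < u s + r"
        proof (rule ccontr)
          assume "\<not> u t < u s + r"
          then have "L t (u s + r) \<le> L t (u t)"
            using mono[of "u s + r" "u t" t] u\<omega>[of t] u\<omega>[of s] r by (cases "u t = u s + r") auto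
          then show False using elim eq[of t] by simp
        qed
        ultimately show ?case using r by (simp add: dist_real_def)
      qed
    qed
    \<comment> \<open>The mean value theorem in the second variable; if \<open>u t = u s\<close>,
      the point \<open>u s\<close> itself serves as \<open>\<xi>\<close>.\<close>
    have "\<exists>\<xi>. 0 < \<xi> \<and> \<xi> < \<omega> \<and> \<bar>\<xi> - u s\<bar> \<le> \<bar>u t - u s\<bar> \<and> L t (u t) - L t (u s) = (u t - u s) * Lu t \<xi>" for t
    proof (cases "u t" "u s" rule: linorder_cases)
      case less
      have "DERIV (L t) x :> Lu t x" if "u t \<le> x" "x \<le> u s" for x
        using that u\<omega>[of t] u\<omega>[of s] by (intro Lu) auto
      from MVT2[OF less this] obtain z
        where "u t < z" "z < u s" "L t (u s) - L t (u t) = (u s - u t) * Lu t z"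
        by blast
      then show ?thesis using u\<omega>[of t] u\<omega>[of s] by (intro exI[of _ z]) (auto simp: algebra_simps)
    next
      case equal
      then show ?thesis using u\<omega>[of s] by (intro exI[of _ "u s"]) auto
    next
      case greater
      have "DERIV (L t) x :> Lu t x" if "u s \<le> x" "x \<le> u t" for x
        using that u\<omega>[of t] u\<omega>[of s] by (intro Lu) auto
      from MVT2[OF greater this] obtain z
        where "u s < z" "z < u t" "L t (u t) - L t (u s) = (u t - u s) * Lu t z"
        by blast
      then show ?thesis using u\<omega>[of t] u\<omega>[of s] by (intro exI[of _ z]) auto
    qed
    then obtain \<xi> where \<xi>: "\<And>t. 0 < \<xi> t \<and> \<xi> t < \<omega> \<and> \<bar>\<xi> t - u s\<bar> \<le> \<bar>u t - u s\<bar> \<and>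
        L t (u t) - L t (u s) = (u t - u s) * Lu t (\<xi> t)" by metis
    have "((\<lambda>t. \<xi> t - u s) \<longlongrightarrow> 0) (at s)"
    proof (rule Lim_null_comparison)
      show "\<forall>\<^sub>F t in at s. norm (\<xi> t - u s) \<le> \<bar>u t - u s\<bar>" using \<xi> by simp
      show "((\<lambda>t. \<bar>u t - u s\<bar>) \<longlongrightarrow> 0) (at s)"
        using contu by (simp add: tendsto_rabs_zero_iff LIM_zero_iff)
    qed
    then have "(\<xi> \<longlongrightarrow> u s) (at s)" by (simp add: LIM_zero_iff)
    then have "((\<lambda>t. (t, \<xi> t)) \<longlongrightarrow> (s, u s)) (at s)" by (intro tendsto_Pair tendsto_ident_at)
    then have "((\<lambda>t. Lu t (\<xi> t)) \<longlongrightarrow> Lu s (u s)) (at s)"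
      using isCont_tendsto_compose[OF cont[OF u\<omega>]] by fastforce
    moreover have "((\<lambda>t. (L t (u s) - L s (u s)) / (t - s)) \<longlongrightarrow> Lt s (u s)) (at s)"
      using Lt[OF u\<omega>[of s], of s] by (simp add: has_field_derivative_iff)
    ultimately have "((\<lambda>t. - ((L t (u s) - L s (u s)) / (t - s)) / Lu t (\<xi> t)) \<longlongrightarrow> - Lt s (u s) / Lu s (u s)) (at s)"
      using pos[OF u\<omega>[of s], of s] by (intro tendsto_divide tendsto_minus) auto
    \<comment> \<open>Along the level curve the increment of \<open>L\<close> in \<open>t\<close>
      and the increment in \<open>u\<close> cancel.\<close>
    moreover have "- ((L t (u s) - L s (u s)) / (t - s)) / Lu t (\<xi> t) = (u t - u s) / (t - s)" for t
    proof -
      have "- (L t (u s) - L s (u s)) = (u t - u s) * Lu t (\<xi> t)" using \<xi>[of t] eq[of t] eq[of s]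
        by simp
      moreover have "Lu t (\<xi> t) \<noteq> 0" using pos[of "\<xi> t" t] \<xi>[of t] by auto
      ultimately have "u t - u s = - (L t (u s) - L s (u s)) / Lu t (\<xi> t)"
        by (simp add: eq_divide_eq)
      then show ?thesis by (simp add: mult.commute minus_divide_left)
    qed
    ultimately show ?thesis by (simp add: has_field_derivative_iff)
  qed
  show thesis by (rule that[OF ub eq uniq der])
qed

section \<open>Periodic solutions from a first integral\<close>

text \<open>The equation \<open>y * y' + B * y + A = 0\<close> solved for \<open>y'\<close>. By
  \<open>reciprocal_solution_iff\<close> these are the reciprocals of the periodic solutions without
  zeros.\<close>

definition reciprocal_solution ::
    "(real \<Rightarrow> real) \<Rightarrow> (real \<Rightarrow> real) \<Rightarrow> (real \<Rightarrow> real) \<Rightarrow> bool" where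
  "reciprocal_solution A B y \<longleftrightarrow>
     (\<forall>t. y t \<noteq> 0) \<and> (\<forall>t. y (t + 2 * pi) = y t) \<and>
     (\<forall>t. (y has_real_derivative - (B t + A t / y t)) (at t))"

lemma reciprocal_solution_iff:
  assumes "\<And>t. y t \<noteq> 0"
  shows "abel_periodic_solution A B (\<lambda>t. 1 / y t) \<longleftrightarrow> reciprocal_solution A B y"
proof -
  have recip: "((\<lambda>t. 1 / f t) has_real_derivative - d / (f t)\<^sup>2) (at t)"
    if "(f has_real_derivative d) (at t)" "f t \<noteq> 0" for f :: "real \<Rightarrow> real" and d t
    using DERIV_inverse'[OF that] by (simp add: power2_eq_square divide_inverse mult_ac)
  have "(y has_real_derivative - (B t + A t / y t)) (at t) \<longleftrightarrow>
      ((\<lambda>t. 1 / y t) has_real_derivative A t * (1 / y t) ^ 3 + B t * (1 / y t) ^ 2) (at t)" for t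
  proof
    assume "(y has_real_derivative - (B t + A t / y t)) (at t)"
    from recip[OF this assms]
    show "((\<lambda>t. 1 / y t) has_real_derivative A t * (1 / y t) ^ 3 + B t * (1 / y t) ^ 2) (at t)"
      by (simp add: add_divide_distrib power2_eq_square power3_eq_cube add.commute mult.assoc)
  next
    assume "((\<lambda>t. 1 / y t) has_real_derivative A t * (1 / y t) ^ 3 + B t * (1 / y t) ^ 2) (at t)"
    from recip[OF this] assms[of t]
    have "(y has_real_derivative - (A t * (1 / y t) ^ 3 + B t * (1 / y t) ^ 2) / (1 / y t)\<^sup>2) (at t)"
      by simp
    moreover have "- (A t * z ^ 3 + B t * z ^ 2) / z\<^sup>2 = - (B t + A t * z)" if "z \<noteq> 0" for z
      using that by (simp add: field_simps power2_eq_square power3_eq_cube)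
    from this[of "1 / y t"] have "- (A t * (1 / y t) ^ 3 + B t * (1 / y t) ^ 2) / (1 / y t)\<^sup>2 = - (B t + A t / y t)"
      using assms[of t] by simp
    ultimately show "(y has_real_derivative - (B t + A t / y t)) (at t)" by simp
  qed
  then show ?thesis using assms by (auto simp: abel_periodic_solution_def reciprocal_solution_def)
qed

lemma reciprocal_solution_continuous:
  "reciprocal_solution A B y \<Longrightarrow> continuous_on UNIV y"
  unfolding reciprocal_solution_def
  by (intro continuous_at_imp_continuous_on ballI) (meson DERIV_isCont)

text \<open>\<open>B\<close> cancels in the difference, and \<open>A / w - A / y\<close> has the
  factor \<open>y - w\<close>. The result is a homogeneous linear equation for the difference, so
  that distinct solutions never meet.\<close>

lemma reciprocal_solution_diff:
  assumes "reciprocal_solution A B y" and "reciprocal_solution A B w"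
  shows "((\<lambda>t. y t - w t) has_real_derivative A t / (y t * w t) * (y t - w t)) (at t)"
proof -
  have "((\<lambda>t. y t - w t) has_real_derivative - (B t + A t / y t) - - (B t + A t / w t)) (at t)"
    using assms unfolding reciprocal_solution_def by (intro DERIV_diff) simp_all
  moreover have "y t \<noteq> 0" "w t \<noteq> 0" using assms by (simp_all add: reciprocal_solution_def)
  then have "- (B t + A t / y t) - - (B t + A t / w t) = A t / (y t * w t) * (y t - w t)"
    by (simp add: right_diff_distrib diff_divide_distrib)
  ultimately show ?thesis by simp
qed

lemma reciprocal_solutions_disjoint:
  assumes y: "reciprocal_solution A B y" and w: "reciprocal_solution A B w"
    and A: "continuous_on UNIV A" and "y \<noteq> w"
  shows "y t \<noteq> w t"
proof
  assume "y t = w t"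
  moreover have "continuous_on UNIV (\<lambda>t. A t / (y t * w t))"
    using y w A reciprocal_solution_continuous[OF y] reciprocal_solution_continuous[OF w]
    by (intro continuous_intros) (auto simp: reciprocal_solution_def)
  ultimately have "y s - w s = 0" for s
    using linear_ode_zero[OF reciprocal_solution_diff[OF y w], of t s] by simp
  with \<open>y \<noteq> w\<close> show False by auto
qed

text \<open>The function \<open>L\<close> below is the logarithm of the first integral in the coordinate \<open>u = v - y0\<close>;
  each of its level curves for a sufficiently low level is the graph of a periodic function.\<close>

lemma nearby_periodic_solution:
  assumes fin: "finite S" and y0: "y0 \<in> S"
    and sol: "\<And>y. y \<in> S \<Longrightarrow> reciprocal_solution A B y"
    and A: "continuous_on UNIV A" and l0: "l y0 \<noteq> 0"
    and rel: "\<And>t. (\<Sum>y\<in>S. l y * (A t / y t)) = 0" and e: "\<epsilon> > 0"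
  shows "\<exists>x. abel_periodic_solution A B x \<and> (\<forall>t. \<bar>x t - 1 / y0 t\<bar> < \<epsilon>) \<and> x \<noteq> (\<lambda>t. 1 / y0 t)"
proof -
  define T where "T = S - {y0}"
  \<comment> \<open>Normalised so that \<open>y0\<close> has weight 1 and contributes exactly
    \<open>ln u\<close> to \<open>L\<close>.\<close>
  define \<mu> where "\<mu> y = l y / l y0" for y
  define D where "D y t = y t - y0 t" for y and t :: real
  define D' where "D' y t = A t / (y t * y0 t) * D y t" for y t
  have finT: "finite T" using fin by (simp add: T_def)
  have sol0: "reciprocal_solution A B y0" using sol y0 .
  have nz0: "y0 t \<noteq> 0" for t using sol0 by (simp add: reciprocal_solution_def)
  have nz: "y t \<noteq> 0" if "y \<in> T" for y t using sol[of y] that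
    by (simp add: reciprocal_solution_def T_def)
  have per0: "y0 (t + 2 * pi) = y0 t" for t using sol0 by (simp add: reciprocal_solution_def)
  have perD: "D y (t + 2 * pi) = D y t" if "y \<in> T" for y t
    using sol[of y] per0 that by (simp add: reciprocal_solution_def T_def D_def)
  have derD: "(D y has_real_derivative D' y t) (at t)" if "y \<in> T" for y t
    unfolding D_def D'_def using that reciprocal_solution_diff[OF sol sol0, of y t]
    by (simp add: T_def)
  have contD: "continuous_on UNIV (D y)" if "y \<in> T" for y
    using derD[OF that] by (auto intro: DERIV_isCont continuous_at_imp_continuous_on)
  have "D y t \<noteq> 0" if "y \<in> T" for y t
    using reciprocal_solutions_disjoint[OF sol sol0 A, of y t] that by (auto simp: D_def T_def)
  then have "\<forall>y\<in>T. \<exists>m>0. \<forall>t. m \<le> \<bar>D y t\<bar>"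
    using perD contD periodic_bounded_away by metis
  then obtain m where m: "\<And>y. y \<in> T \<Longrightarrow> 0 < m y" "\<And>y t. y \<in> T \<Longrightarrow> m y \<le> \<bar>D y t\<bar>" by metis
  obtain m0 where m0: "0 < m0" "\<And>t. m0 \<le> \<bar>y0 t\<bar>"
    using periodic_bounded_away[of y0] per0 reciprocal_solution_continuous[OF sol0] nz0 by auto
  have "\<forall>y\<in>T. \<exists>K. \<forall>t. \<bar>D y t\<bar> \<le> K" using perD contD periodic_bounded by metis
  then obtain K where K: "\<And>y t. y \<in> T \<Longrightarrow> \<bar>D y t\<bar> \<le> K y" by metis
  \<comment> \<open>Half of a lower bound for the distances of \<open>y0\<close> to \<open>0\<close>
    and to the other solutions. For \<open>0 < u \<le> \<eta>\<close> the curve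
    \<open>y0 + u\<close> thus stays at distance at least \<open>\<eta>\<close> from all of
    them.\<close>
  define \<eta> where "\<eta> = Min (insert m0 (m ` T)) / 2"
  have \<eta>0: "0 < \<eta>" using finT m(1) m0(1) by (simp add: \<eta>_def)
  have "Min (insert m0 (m ` T)) \<le> m0" using finT by (intro Min_le) auto
  then have \<eta>y0: "2 * \<eta> \<le> \<bar>y0 t\<bar>" for t using m0(2)[of t] by (simp add: \<eta>_def)
  have \<eta>D: "2 * \<eta> \<le> \<bar>D y t\<bar>" if "y \<in> T" for y t
  proof -
    have "Min (insert m0 (m ` T)) \<le> m y" using finT that by (intro Min_le) auto
    then show ?thesis using m(2)[OF that, of t] by (simp add: \<eta>_def)
  qed
  define M where "M = (\<Sum>y\<in>T. \<bar>\<mu> y\<bar>)"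
  have M0: "0 \<le> M" by (simp add: M_def sum_nonneg)
  \<comment> \<open>For \<open>u < \<omega>\<close> the term \<open>1 / u\<close> exceeds
    \<open>(M + 1) / \<eta>\<close> and hence dominates the other terms of \<open>Lu\<close>, which
    makes \<open>L\<close> increasing in \<open>u\<close>.\<close>
  define \<omega> where "\<omega> = \<eta> / (M + 1)"
  have \<omega>: "0 < \<omega>" "\<omega> \<le> \<eta>" using \<eta>0 M0 by (auto simp: \<omega>_def divide_le_eq)
  have Du: "\<eta> \<le> \<bar>D y t - u\<bar>" if "y \<in> T" "0 < u" "u < \<omega>" for y t u
    using \<eta>D[OF that(1), of t] that \<omega> by linarith
  have Du0: "D y t - u \<noteq> 0" if "y \<in> T" "0 < u" "u < \<omega>" for y t u
    using Du[OF that, of t] \<eta>0 by auto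
  \<comment> \<open>With \<open>v = y0 + u\<close> one has \<open>D y t - u = y - v\<close>. Half
    the logarithm of the square is the logarithm of the absolute value, in a form that needs no
    distinction of signs when differentiating.\<close>
  define L where "L t u = ln u + (\<Sum>y\<in>T. \<mu> y / 2 * ln ((D y t - u)\<^sup>2))" for t u
  define Lu where "Lu t u = 1 / u - (\<Sum>y\<in>T. \<mu> y / (D y t - u))" for t u
  define Lt where "Lt t u = (\<Sum>y\<in>T. \<mu> y * D' y t / (D y t - u))" for t u
  have ln_sq: "((\<lambda>s. c / 2 * ln ((f s)\<^sup>2)) has_real_derivative c * f' / f s) (at s)"
    if "(f has_real_derivative f') (at s)" "f s \<noteq> 0" for f f' c and s :: real
  proof -
    have "((\<lambda>s. ln ((f s)\<^sup>2)) has_real_derivative 2 * f s * f' / (f s)\<^sup>2) (at s)"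
      using that(2) by (auto intro!: derivative_eq_intros that(1))
    from DERIV_cmult[OF this, of "c / 2"] show ?thesis
      using that(2) by (simp add: power2_eq_square)
  qed
  have Lu: "(L t has_real_derivative Lu t u) (at u)" if "0 < u" "u < \<omega>" for t u
  proof -
    have "((\<lambda>u. \<mu> y / 2 * ln ((D y t - u)\<^sup>2)) has_real_derivative - (\<mu> y / (D y t - u))) (at u)"
      if "y \<in> T" for y
    proof -
      have "((\<lambda>u. D y t - u) has_real_derivative - 1) (at u)" by (auto intro!: derivative_eq_intros)
      from ln_sq[OF this Du0[OF that \<open>0 < u\<close> \<open>u < \<omega>\<close>]] show ?thesis by simp
    qed
    then have "((\<lambda>u. \<Sum>y\<in>T. \<mu> y / 2 * ln ((D y t - u)\<^sup>2)) has_real_derivative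
        (\<Sum>y\<in>T. - (\<mu> y / (D y t - u)))) (at u)"
      by (intro DERIV_sum) auto
    from DERIV_add[OF DERIV_ln_divide[OF that(1)] this]
    show ?thesis unfolding L_def Lu_def sum_negf by simp
  qed
  have Lt: "((\<lambda>t. L t u) has_real_derivative Lt t u) (at t)" if "0 < u" "u < \<omega>" for t u
  proof -
    have "((\<lambda>t. \<mu> y / 2 * ln ((D y t - u)\<^sup>2)) has_real_derivative \<mu> y * D' y t / (D y t - u)) (at t)"
      if "y \<in> T" for y
    proof -
      have "((\<lambda>t. D y t - u) has_real_derivative D' y t) (at t)"
        by (auto intro!: derivative_eq_intros derD[OF that])
      from ln_sq[OF this Du0[OF that \<open>0 < u\<close> \<open>u < \<omega>\<close>]] show ?thesis .
    qed
    then have "((\<lambda>t. \<Sum>y\<in>T. \<mu> y / 2 * ln ((D y t - u)\<^sup>2)) has_real_derivative Lt t u) (at t)"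
      unfolding Lt_def by (intro DERIV_sum) auto
    from DERIV_add[OF DERIV_const this] show ?thesis unfolding L_def by simp
  qed
  have pos: "0 < Lu t u" if "0 < u" "u < \<omega>" for t u
  proof -
    have "(\<Sum>y\<in>T. \<mu> y / (D y t - u)) \<le> (\<Sum>y\<in>T. \<bar>\<mu> y\<bar> / \<eta>)"
    proof (rule sum_mono)
      fix y assume "y \<in> T"
      have "\<mu> y / (D y t - u) \<le> \<bar>\<mu> y\<bar> / \<bar>D y t - u\<bar>" by (metis abs_divide abs_ge_self)
      also have "\<dots> \<le> \<bar>\<mu> y\<bar> / \<eta>" using Du[OF \<open>y \<in> T\<close> that, of t] \<eta>0
        by (intro divide_left_mono mult_pos_pos) auto
      finally show "\<mu> y / (D y t - u) \<le> \<bar>\<mu> y\<bar> / \<eta>" .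
    qed
    also have "\<dots> = M / \<eta>" by (simp add: M_def sum_divide_distrib)
    also have "\<dots> < (M + 1) / \<eta>" using \<eta>0 by (simp add: divide_strict_right_mono)
    also have "\<dots> = 1 / \<omega>" by (simp add: \<omega>_def)
    also have "\<dots> < 1 / u" using that \<omega> by (intro divide_strict_left_mono) auto
    finally show ?thesis by (simp add: Lu_def)
  qed
  have cont: "isCont (\<lambda>p. Lu (fst p) (snd p)) (t, u)" if "0 < u" "u < \<omega>" for t u
  proof -
    have "isCont (\<lambda>p. D y (fst p)) (t, u)" if "y \<in> T" for y
      by (rule isCont_o2[OF isCont_fst[OF continuous_ident]]) (use DERIV_isCont[OF derD[OF that]] in simp)
    then show ?thesis unfolding Lu_def using Du0[OF _ that] that(1)
      by (intro continuous_intros) auto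
  qed
  define K2 where "K2 y = \<bar>ln (\<eta>\<^sup>2)\<bar> + \<bar>ln ((K y + \<eta>)\<^sup>2)\<bar>" for y
  define K1 where "K1 = (\<Sum>y\<in>T. \<bar>\<mu> y / 2\<bar> * K2 y)"
  \<comment> \<open>The bound is uniform in \<open>t\<close> and \<open>u\<close>, so
    \<open>L\<close> tends to minus infinity like \<open>ln u\<close>, uniformly in
    \<open>t\<close>.\<close>
  have bnd: "\<bar>L t u - ln u\<bar> \<le> K1" if "0 < u" "u < \<omega>" for t u
  proof -
    have "\<bar>L t u - ln u\<bar> \<le> (\<Sum>y\<in>T. \<bar>\<mu> y / 2 * ln ((D y t - u)\<^sup>2)\<bar>)"
      unfolding L_def add_diff_cancel_left' by (rule sum_abs)
    also have "\<dots> \<le> K1"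
      unfolding K1_def
    proof (rule sum_mono)
      fix y assume y: "y \<in> T"
      have "\<eta>\<^sup>2 \<le> (D y t - u)\<^sup>2" using Du[OF y that, of t] \<eta>0
        by (simp add: abs_le_square_iff[symmetric])
      moreover have "(D y t - u)\<^sup>2 \<le> (K y + \<eta>)\<^sup>2"
        using K[OF y, of t] that \<omega> by (simp add: abs_le_square_iff[symmetric])
      moreover have "0 < \<eta>\<^sup>2" using \<eta>0 by simp
      ultimately have "ln (\<eta>\<^sup>2) \<le> ln ((D y t - u)\<^sup>2)" "ln ((D y t - u)\<^sup>2) \<le> ln ((K y + \<eta>)\<^sup>2)"
        by (auto intro!: ln_mono)
      then have "\<bar>ln ((D y t - u)\<^sup>2)\<bar> \<le> K2 y" unfolding K2_def by linarith
      then show "\<bar>\<mu> y / 2 * ln ((D y t - u)\<^sup>2)\<bar> \<le> \<bar>\<mu> y / 2\<bar> * K2 y"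
        unfolding abs_mult by (intro mult_left_mono) auto
    qed
    finally show ?thesis .
  qed
  \<comment> \<open>Since \<open>1 / v\<close> and \<open>1 / y0\<close> differ by at most
    \<open>u / \<eta>\<^sup>2\<close>, the second bound on \<open>u\<close> puts them within
    \<open>\<epsilon>\<close>.\<close>
  define b where "b = min (\<omega> / 2) (\<epsilon> * \<eta>\<^sup>2)"
  have b: "0 < b" "b < \<omega>" "b \<le> \<epsilon> * \<eta>\<^sup>2" using \<omega> e \<eta>0 by (auto simp: b_def)
  \<comment> \<open>By \<open>bnd\<close>, \<open>L t b\<close> is at least \<open>C + 1\<close> and
    \<open>L t a\<close> is at most \<open>C - 1\<close>, for every \<open>t\<close>.\<close>
  define C where "C = ln b - K1 - 1"
  define a where "a = exp (C - K1 - 1)"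
  have K10: "0 \<le> K1" using bnd[OF b(1,2), of 0] by linarith
  have a0: "0 < a" by (simp add: a_def)
  have "ln a < ln b" using K10 by (simp add: a_def C_def)
  then have ab: "a < b" using a0 b by simp
  have Ca: "L t a < C" for t using bnd[of a t] a0 ab b unfolding a_def by simp
  have Cb: "C < L t b" for t using bnd[of b t] b unfolding C_def by linarith
  obtain u where ub: "\<And>t. a < u t \<and> u t < b" and uC: "\<And>t. L t (u t) = C"
    and uniq: "\<And>t v. 0 < v \<Longrightarrow> v < \<omega> \<Longrightarrow> L t v = C \<Longrightarrow> v = u t"
    and der: "\<And>t. (u has_real_derivative - Lt t (u t) / Lu t (u t)) (at t)"
    using implicit_curve[of \<omega> L Lu Lt a b C, OF Lu pos cont Lt a0 ab b(2) Ca Cb] by blast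
  have u\<omega>: "0 < u t" "u t < \<omega>" for t using ub[of t] a0 b by auto
  define v where "v t = y0 t + u t" for t
  have uv: "u t = v t - y0 t" for t by (simp add: v_def)
  have v: "\<eta> \<le> \<bar>v t\<bar>" for t using \<eta>y0[of t] u\<omega>[of t] \<omega> by (simp add: v_def)
  have v0: "v t \<noteq> 0" for t using v[of t] \<eta>0 by auto
  \<comment> \<open>\<open>L\<close> is periodic in \<open>t\<close>, so both values lie on the same
    level of \<open>L t\<close>, where the point is unique.\<close>
  have "u (t + 2 * pi) = u t" for t
  proof (rule uniq)
    have "L (t + 2 * pi) w = L t w" for w unfolding L_def using perD by simp
    then show "L t (u (t + 2 * pi)) = C" using uC[of "t + 2 * pi"] by simp
  qed (rule u\<omega>)+
  then have perv: "v (t + 2 * pi) = v t" for t by (simp add: v_def per0)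
  \<comment> \<open>For \<open>v = y0 + u\<close> to be a solution, \<open>u\<close> must satisfy
    the linear equation of \<open>reciprocal_solution_diff\<close>. That the level curve does so is
    where the relation \<open>rel\<close> enters.\<close>
  have slope: "- Lt t (u t) / Lu t (u t) = A t / (v t * y0 t) * u t" for t
  proof -
    \<comment> \<open>The relation divided by \<open>l y0 * v t\<close>, with the summand of
      \<open>y0\<close> split off.\<close>
    have "A t / (y0 t * v t) + (\<Sum>y\<in>T. \<mu> y * (A t / (y t * v t))) = (\<Sum>y\<in>S. l y * (A t / y t)) / (l y0 * v t)"
      unfolding T_def sum.remove[OF fin y0] using l0 nz0[of t] v0[of t]
      by (simp add: add_divide_distrib sum_divide_distrib \<mu>_def mult_ac)
    then have 1: "A t / (y0 t * v t) + (\<Sum>y\<in>T. \<mu> y * (A t / (y t * v t))) = 0"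
      by (simp only: rel div_0)
    \<comment> \<open>\<open>D' y t\<close> is \<open>A / y0 - A / y\<close> and the slope is
      \<open>A / y0 - A / v\<close>. Their difference \<open>A / v - A / y\<close> has the factor
      \<open>y - v\<close>, which cancels against \<open>D y t - u t\<close>.\<close>
    have 2: "\<mu> y * D' y t / (D y t - u t) - \<mu> y / (D y t - u t) * (A t / (v t * y0 t) * u t)
        = \<mu> y * (A t / (y t * v t))" if "y \<in> T" for y
    proof -
      have d: "D y t - u t \<noteq> 0" using Du0[OF that u\<omega>] .
      have "D' y t - A t / (v t * y0 t) * u t = A t / (y t * v t) * (D y t - u t)"
        using nz[OF that, of t] nz0[of t] v0[of t]
        by (simp add: D'_def D_def uv right_diff_distrib diff_divide_distrib)
      then have "\<mu> y * (D' y t - A t / (v t * y0 t) * u t) / (D y t - u t) = \<mu> y * (A t / (y t * v t))"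
        using d by simp
      moreover have "c * (p - q) / r = c * p / r - c / r * q" for c p q r :: real
        by (simp add: right_diff_distrib diff_divide_distrib)
      ultimately show ?thesis by (simp only:)
    qed
    have "Lt t (u t) + Lu t (u t) * (A t / (v t * y0 t) * u t)
      = A t / (y0 t * v t) + (\<Sum>y\<in>T. \<mu> y * D' y t / (D y t - u t) - \<mu> y / (D y t - u t) * (A t / (v t * y0 t) * u t))"
    proof -
      have q: "1 / u t * (A t / (v t * y0 t) * u t) = A t / (y0 t * v t)"
        using u\<omega>(1)[of t] by (simp add: mult.commute)
      show ?thesis
        unfolding Lt_def Lu_def left_diff_distrib sum_distrib_right q sum_subtractf by simp
    qed
    also have "\<dots> = A t / (y0 t * v t) + (\<Sum>y\<in>T. \<mu> y * (A t / (y t * v t)))" using 2 by simp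
    finally have "Lt t (u t) + Lu t (u t) * (A t / (v t * y0 t) * u t) = 0" using 1 by simp
    then have "- Lt t (u t) = Lu t (u t) * (A t / (v t * y0 t) * u t)" by linarith
    moreover have "Lu t (u t) \<noteq> 0" using pos[OF u\<omega>, of t t] by simp
    ultimately show ?thesis by simp
  qed
  have "(v has_real_derivative - (B t + A t / v t)) (at t)" for t
  proof -
    have "(v has_real_derivative - (B t + A t / y0 t) + A t / (v t * y0 t) * u t) (at t)"
      unfolding v_def[abs_def] using sol0 der[of t] slope[of t, unfolded v_def]
      by (intro DERIV_add) (auto simp: reciprocal_solution_def)
    moreover have "- (B t + A t / y0 t) + A t / (v t * y0 t) * u t = - (B t + A t / v t)"
      using nz0[of t] v0[of t] by (simp add: uv right_diff_distrib diff_divide_distrib)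
    ultimately show ?thesis by (simp only:)
  qed
  then have "abel_periodic_solution A B (\<lambda>t. 1 / v t)"
    using reciprocal_solution_iff[OF v0] perv v0 by (simp add: reciprocal_solution_def)
  moreover have "\<bar>1 / v t - 1 / y0 t\<bar> < \<epsilon>" for t
  proof -
    have "1 / v t - 1 / y0 t = - (u t / (v t * y0 t))"
      using nz0[of t] v0[of t] by (simp add: uv right_diff_distrib diff_divide_distrib)
    then have "\<bar>1 / v t - 1 / y0 t\<bar> = u t / (\<bar>v t\<bar> * \<bar>y0 t\<bar>)"
      using u\<omega>(1)[of t] by (simp add: abs_mult)
    also have "\<dots> \<le> u t / (\<eta> * \<eta>)"
      using v[of t] \<eta>y0[of t] \<eta>0 u\<omega>(1)[of t] v0[of t] nz0[of t]
      by (intro divide_left_mono mult_mono mult_pos_pos) auto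
    also have "\<dots> < b / (\<eta> * \<eta>)" using ub[of t] \<eta>0 by (intro divide_strict_right_mono) auto
    also have "\<dots> \<le> \<epsilon>" using b(3) \<eta>0 by (simp add: divide_le_eq power2_eq_square)
    finally show ?thesis .
  qed
  moreover have "(\<lambda>t. 1 / v t) \<noteq> (\<lambda>t. 1 / y0 t)"
  proof
    assume "(\<lambda>t. 1 / v t) = (\<lambda>t. 1 / y0 t)"
    then have "1 / v 0 = 1 / y0 0" by metis
    then show False using u\<omega>(1)[of 0] by (simp add: v_def)
  qed
  ultimately show ?thesis by blast
qed

section \<open>Degrees and counting\<close>

lemma trig_poly_continuous:
  assumes "trig_poly f"
  shows "continuous_on UNIV f"
proof -
  obtain n a b where f: "f = (\<lambda>t. \<Sum>k\<le>n. a k * cos (real k * t) + b k * sin (real k * t))"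
    using assms by (auto simp: trig_poly_def trig_expansion_def)
  show ?thesis unfolding f by (intro continuous_intros)
qed

lemma laurent_rep_add_exists:
  assumes "laurent_rep f j p" and "laurent_rep g k q"
  shows "\<exists>n r. laurent_rep (\<lambda>t. f t + g t) n r"
  using laurent_rep_add[OF laurent_rep_shift[OF assms(1), of k]
      laurent_rep_shift[OF assms(2), of j, unfolded add.commute[of k j]]] by blast

lemma laurent_degree_rep: "laurent_degree f d \<Longrightarrow> \<exists>p. laurent_rep f d p"
  by (auto simp: laurent_degree_def)

text \<open>The degrees of \<open>D\<close> and \<open>D'\<close> cancel in
  \<open>D' * y * w = A * D\<close> because differentiation preserves every positive degree.\<close>

lemma laurent_degree_solutions:
  assumes A: "trig_poly A" "A \<noteq> (\<lambda>t. 0)"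
    and y: "reciprocal_solution A B y" "laurent_degree y d"
    and w: "reciprocal_solution A B w" "laurent_degree w e"
    and "y \<noteq> w"
  shows "d + e = trig_degree A"
proof -
  define D where "D t = y t - w t" for t
  define D' where "D' t = A t / (y t * w t) * D t" for t
  have D': "(D has_real_derivative D' t) (at t)" for t
    unfolding D_def D'_def by (rule reciprocal_solution_diff[OF y(1) w(1)])
  have nz: "D t \<noteq> 0" for t
    using reciprocal_solutions_disjoint[OF y(1) w(1) trig_poly_continuous[OF A(1)] \<open>y \<noteq> w\<close>, of t]
    by (simp add: D_def)
  have yw: "y t \<noteq> 0" "w t \<noteq> 0" for t using y(1) w(1) by (simp_all add: reciprocal_solution_def)
  obtain p q where p: "laurent_rep y d p" and q: "laurent_rep w e q"
    using y(2) w(2) laurent_degree_rep by blast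
  obtain n r where "laurent_rep D n r"
    using laurent_rep_add_exists[OF p laurent_rep_cmult[OF q, of "-1"]]
    by (auto simp: D_def[abs_def])
  moreover have "D \<noteq> (\<lambda>t. 0)" using nz by metis
  ultimately obtain \<delta> where \<delta>: "laurent_degree D \<delta>" using laurent_degree_exists by blast
  \<comment> \<open>A constant \<open>D\<close> would have \<open>D' = 0\<close> and, being nowhere
    zero, would force \<open>A = 0\<close>.\<close>
  have "\<delta> \<noteq> 0"
  proof
    assume "\<delta> = 0"
    then have "D = (\<lambda>t. D 0)" using \<delta> laurent_degree_0_constant by blast
    then have "D' t = 0" for t using D'[of t] by (metis DERIV_const DERIV_unique)
    then have "A t = 0" for t using nz[of t] yw[of t] by (auto simp: D'_def)
    then show False using A(2) by auto
  qed
  then have "laurent_degree D' \<delta>" using laurent_degree_deriv[OF \<delta> _ D'] by simp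
  then have "laurent_degree (\<lambda>t. D' t * (y t * w t)) (\<delta> + (d + e))"
    by (intro laurent_degree_mult y w)
  moreover have "(\<lambda>t. D' t * (y t * w t)) = (\<lambda>t. A t * D t)" using yw by (simp add: D'_def)
  moreover have "laurent_degree (\<lambda>t. A t * D t) (trig_degree A + \<delta>)"
    by (intro laurent_degree_mult laurent_degree_trig_degree A \<delta>)
  ultimately have "\<delta> + (d + e) = trig_degree A + \<delta>" using laurent_degree_unique by metis
  then show ?thesis by simp
qed

text \<open>\<open>g = A / y\<close> equals \<open>- (y' + B)\<close> and is therefore a Laurent
  polynomial; \<open>y * g = A\<close> then gives it the degree \<open>2 * d - d = d\<close>. Hence
  \<open>B = - (y' + g)\<close> has no exponent above \<open>d\<close>.\<close>

lemma laurent_degree_half: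
  assumes A: "trig_poly A" "A \<noteq> (\<lambda>t. 0)" and B: "trig_poly B"
    and y: "reciprocal_solution A B y" "laurent_degree y d"
    and "trig_degree A = 2 * d"
  shows "trig_degree B \<le> d" and "\<exists>p. laurent_rep (\<lambda>t. A t / y t) d p \<and> degree p \<le> 2 * d"
proof -
  define g where "g t = A t / y t" for t
  have y0: "y t \<noteq> 0" for t using y(1) by (simp add: reciprocal_solution_def)
  have y': "(y has_real_derivative - (B t + g t)) (at t)" for t
    using y(1) unfolding reciprocal_solution_def g_def by blast
  obtain p where p: "laurent_rep y d p" "p \<noteq> 0" "degree p = 2 * d"
    using y(2) by (auto simp: laurent_degree_def)
  define p' where "p' = smult \<i> (pCons 0 (pderiv p) - smult (of_nat d) p)"
  have p': "laurent_rep (\<lambda>t. - (B t + g t)) d p'"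
    unfolding p'_def by (rule laurent_rep_deriv[OF p(1) y'])
  obtain k b where b: "laurent_rep B k b" using trig_poly_laurent_rep[OF B] by blast
  have "\<exists>n r. laurent_rep g n r"
    using laurent_rep_add_exists[OF laurent_rep_cmult[OF p', of "-1"] laurent_rep_cmult[OF b, of "-1"]]
    by simp
  moreover have "g \<noteq> (\<lambda>t. 0)"
  proof
    assume "g = (\<lambda>t. 0)"
    then have "A t / y t = 0" for t by (metis g_def)
    then have "A t = 0" for t using y0[of t] divide_eq_0_iff by blast
    with A(2) show False by auto
  qed
  ultimately obtain e where e: "laurent_degree g e" using laurent_degree_exists by blast
  have "laurent_degree (\<lambda>t. y t * g t) (d + e)" by (intro laurent_degree_mult y e)
  moreover have "(\<lambda>t. y t * g t) = A" using y0 by (simp add: g_def)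
  ultimately have "d + e = trig_degree A"
    using laurent_degree_unique laurent_degree_trig_degree[OF A] by metis
  then have "e = d" using assms(6) by simp
  then obtain q where q: "laurent_rep g d q" "degree q \<le> 2 * d" using e
    by (auto simp: laurent_degree_def)
  then show "\<exists>p. laurent_rep (\<lambda>t. A t / y t) d p \<and> degree p \<le> 2 * d"
    unfolding g_def by blast
  show "trig_degree B \<le> d"
  proof (cases "B = (\<lambda>t. 0)")
    case True
    then show ?thesis by (simp add: trig_degree_def)
  next
    case False
    have "degree (pCons 0 (pderiv p)) \<le> 2 * d"
      using p(3) by (auto simp: degree_pCons_eq_if degree_pderiv pderiv_eq_0_iff)
    then have "degree p' \<le> 2 * d"
      using p(3) unfolding p'_def by (intro order.trans[OF degree_smult_le] degree_diff_le) auto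
    then have "degree (smult (of_real (- 1)) p' + smult (of_real (- 1)) q) \<le> 2 * d"
      using q(2) by (intro degree_add_le order.trans[OF degree_smult_le])
    moreover have "laurent_rep B d (smult (of_real (- 1)) p' + smult (of_real (- 1)) q)"
      using laurent_rep_add[OF laurent_rep_cmult[OF p', of "-1"] laurent_rep_cmult[OF q(1), of "-1"]]
      by simp
    ultimately show ?thesis
      using laurent_degree_le[OF laurent_degree_trig_degree[OF B False]] by blast
  qed
qed

section \<open>Reciprocals of limit cycles, their independence and their number\<close>

lemma nontrivial_cycle_nonzero:
  assumes "trig_poly A" and "trig_poly B" and "x \<in> nontrivial_rational_limit_cycles A B"
  shows "\<forall>t. x t \<noteq> 0" and "\<exists>k p. laurent_rep (\<lambda>t. 1 / x t) k p"
    and "reciprocal_solution A B (\<lambda>t. 1 / x t)"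
proof -
  obtain P Q where PQ: "trig_poly P" "trig_poly Q" "\<And>t. P t \<noteq> 0" "x = (\<lambda>t. Q t / P t)"
    and x: "abel_periodic_solution A B x" "x \<noteq> (\<lambda>t. 0)"
    using assms(3)
    by (auto simp: nontrivial_rational_limit_cycles_def rational_limit_cycle_def abel_limit_cycle_def)
  have "(x has_real_derivative A t * x t ^ 3 + B t * x t ^ 2) (at t)" for t
    using x(1) by (simp add: abel_periodic_solution_def)
  note * = rational_solution_reciprocal[OF assms(1,2) PQ x(2) this]
  show nz: "\<forall>t. x t \<noteq> 0" and "\<exists>k p. laurent_rep (\<lambda>t. 1 / x t) k p" using * by blast+
  show "reciprocal_solution A B (\<lambda>t. 1 / x t)"
    using reciprocal_solution_iff[of "\<lambda>t. 1 / x t" A B] nz x(1) by simp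
qed

text \<open>For \<open>l y \<noteq> 0\<close>, \<open>nearby_periodic_solution\<close> with the
  isolation radius of \<open>1 / y\<close> yields a second periodic solution within that
  radius.\<close>

lemma reciprocal_cycles_independent:
  assumes A: "trig_poly A" and B: "trig_poly B" and fin: "finite S"
    and S: "S \<subseteq> (\<lambda>x t. 1 / x t) ` nontrivial_rational_limit_cycles A B"
    and rel: "\<And>t. (\<Sum>y\<in>S. l y * (A t / y t)) = 0" and y: "y \<in> S"
  shows "l y = 0"
proof (rule ccontr)
  assume ly: "l y \<noteq> 0"
  obtain x where x: "x \<in> nontrivial_rational_limit_cycles A B" "y = (\<lambda>t. 1 / x t)" using S y
    by blast
  have "abel_limit_cycle A B x"
    using x(1) by (simp add: nontrivial_rational_limit_cycles_def rational_limit_cycle_def)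
  then obtain \<epsilon> where e: "\<epsilon> > 0"
    "\<And>z. abel_periodic_solution A B z \<Longrightarrow> (\<forall>t. \<bar>z t - x t\<bar> < \<epsilon>) \<Longrightarrow> z = x"
    by (auto simp: abel_limit_cycle_def)
  have sol: "reciprocal_solution A B w" if "w \<in> S" for w
    using S that nontrivial_cycle_nonzero(3)[OF A B] by blast
  obtain z where "abel_periodic_solution A B z" "\<forall>t. \<bar>z t - 1 / y t\<bar> < \<epsilon>" "z \<noteq> (\<lambda>t. 1 / y t)"
    using nearby_periodic_solution[OF fin y sol trig_poly_continuous[OF A] ly rel e(1)] by blast
  then show False using e(2)[of z] x(2) by simp
qed

text \<open>Treats infinite and too large finite sets alike, so that finiteness and the bound are
  refuted together.\<close>

lemma larger_subset_exists:
  assumes "\<not> (finite Y \<and> card Y \<le> n)"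
  shows "\<exists>S\<subseteq>Y. finite S \<and> card S = Suc n"
proof (cases "finite Y")
  case True
  with assms have "Suc n \<le> card Y" by simp
  then show ?thesis by (metis obtain_subset_with_card_n)
next
  case False
  then show ?thesis using infinite_arbitrarily_large by blast
qed

theorem theorem1p1:
  fixes A B :: "real \<Rightarrow> real"
  assumes "trig_poly A" and "trig_poly B"
  shows "(odd (trig_degree A) \<or> trig_degree A < 2 * trig_degree B \<longrightarrow>
            finite (nontrivial_rational_limit_cycles A B) \<and>
            card (nontrivial_rational_limit_cycles A B) \<le> 2) \<and>
         (\<not> (odd (trig_degree A) \<or> trig_degree A < 2 * trig_degree B) \<longrightarrow>
            finite (nontrivial_rational_limit_cycles A B) \<and>
            card (nontrivial_rational_limit_cycles A B) \<le> trig_degree A + 1)"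
proof -
  define N where "N = nontrivial_rational_limit_cycles A B"
  define Y where "Y = (\<lambda>x t. 1 / x t) ` N"
  have "inj_on (\<lambda>x t. 1 / x t :: real) N"
  proof (rule inj_onI)
    fix x z :: "real \<Rightarrow> real"
    assume "(\<lambda>t. 1 / x t) = (\<lambda>t. 1 / z t)"
    then have "1 / (1 / x t) = 1 / (1 / z t)" for t by metis
    then show "x = z" by auto
  qed
  then have card: "finite N = finite Y" "card N = card Y"
    unfolding Y_def by (simp_all add: finite_image_iff card_image)
  note indep = reciprocal_cycles_independent[OF assms, folded N_def, folded Y_def]
  have sol: "reciprocal_solution A B y" and rep: "\<exists>k p. laurent_rep y k p" if "y \<in> Y" for y
    using that nontrivial_cycle_nonzero(2,3)[OF assms] unfolding Y_def N_def by blast+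
  show ?thesis
  proof (cases "A = (\<lambda>t. 0)")
    case True
    \<comment> \<open>For \<open>A = 0\<close> a single \<open>y\<close> with coefficient 1 already
      satisfies the linear relation, contrary to independence.\<close>
    have "Y = {}"
    proof (rule ccontr)
      assume "Y \<noteq> {}"
      then obtain y where "y \<in> Y" by blast
      then show False using indep[of "{y}" "\<lambda>_. 1" y] True by simp
    qed
    then show ?thesis unfolding N_def[symmetric] card by simp
  next
    case False
    have "\<exists>d. laurent_degree y d" if "y \<in> Y" for y
    proof -
      have "y t \<noteq> 0" for t using sol[OF that] by (simp add: reciprocal_solution_def)
      then show ?thesis using rep[OF that] laurent_degree_exists by metis
    qed
    then obtain deg where deg: "\<And>y. y \<in> Y \<Longrightarrow> laurent_degree y (deg y)" by metis
    have sum: "deg y + deg w = trig_degree A" if "y \<in> Y" "w \<in> Y" "y \<noteq> w" for y w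
      using laurent_degree_solutions[OF assms(1) False sol deg sol deg] that by blast
    \<comment> \<open>Three pairwise sums that agree force the three degrees to be equal.\<close>
    have half: "trig_degree A = 2 * deg y" if "y \<in> Y" "w \<in> Y" "z \<in> Y" "y \<noteq> w" "y \<noteq> z" "w \<noteq> z" for y w z
      using sum[of y w] sum[of y z] sum[of w z] that by simp
    have "finite Y \<and> card Y \<le> 2" if "odd (trig_degree A) \<or> trig_degree A < 2 * trig_degree B"
    proof (rule ccontr)
      assume "\<not> (finite Y \<and> card Y \<le> 2)"
      then obtain S where "S \<subseteq> Y" "card S = 3" using larger_subset_exists[of Y 2] by auto
      then obtain y w z where "y \<in> Y" "w \<in> Y" "z \<in> Y" "y \<noteq> w" "y \<noteq> z" "w \<noteq> z"
        by (auto simp: card_3_iff)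
      then have "trig_degree A = 2 * deg y" "y \<in> Y" using half by blast+
      then show False
        using laurent_degree_half(1)[OF assms(1) False assms(2) sol deg, of y] that by simp
    qed
    moreover have "finite Y \<and> card Y \<le> trig_degree A + 1"
      if "\<not> (odd (trig_degree A) \<or> trig_degree A < 2 * trig_degree B)"
    proof (rule ccontr)
      assume "\<not> (finite Y \<and> card Y \<le> trig_degree A + 1)"
      then obtain S where S: "S \<subseteq> Y" "finite S" "card S = trig_degree A + 2"
        using larger_subset_exists[of Y "trig_degree A + 1"] by auto
      have degS: "trig_degree A = 2 * deg y" if "y \<in> S" for y
      \<comment> \<open>For degree 0 the set \<open>S\<close> has only two elements and
        \<open>half\<close> does not apply; the two degrees then sum to 0 and both vanish.\<close>
      proof (cases "trig_degree A = 0")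
        case True
        have "card (S - {y}) = 1" using S that True by simp
        then obtain w where "S - {y} = {w}" by (auto simp: card_1_singleton_iff)
        then have "deg y + deg w = trig_degree A" using S that by (intro sum) auto
        then show ?thesis using True by simp
      next
        case False
        then have "2 \<le> card (S - {y})" using S that by simp
        then obtain R where "R \<subseteq> S - {y}" "card R = 2" using obtain_subset_with_card_n by metis
        then obtain w z where "w \<in> S - {y}" "z \<in> S - {y}" "w \<noteq> z" by (auto simp: card_2_iff)
        then show ?thesis using S that by (intro half[of y w z]) auto
      qed
      define d where "d = trig_degree A div 2"
      have d: "trig_degree A = 2 * d" "\<And>y. y \<in> S \<Longrightarrow> deg y = d" using degS that by (auto simp: d_def)
      have "\<exists>p. laurent_rep (\<lambda>t. A t / y t) d p \<and> degree p \<le> 2 * d" if "y \<in> S" for y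
        using laurent_degree_half(2)[OF assms(1) False assms(2) sol deg, of y] d that S by auto
      \<comment> \<open>\<open>S\<close> has \<open>2 * d + 2\<close> elements, one more than the
        number of exponents from \<open>-d\<close> to \<open>d\<close>.\<close>
      moreover have "2 * d + 1 < card S" using S(3) d(1) by simp
      ultimately obtain l where "\<exists>y\<in>S. l y \<noteq> 0" "\<forall>t. (\<Sum>y\<in>S. l y * (A t / y t)) = 0"
        using laurent_dependent[OF S(2), of d "\<lambda>y t. A t / y t"] by blast
      then show False using indep[OF S(2,1), of l] by blast
    qed
    ultimately show ?thesis unfolding N_def[symmetric] card by blast
  qed
qed

end
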